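(* (a) For every integer $n\ge 2$, the U-independence system of the diagram $D_n$ (a non-minimal diagram, with unknotting number $u(D_n)=n$, of the knot with Conway notation $(2n+1,1,2n)$; described in the context) is not a matroid. (b) For every integer $n\ge 1$, the U-independence system of the knot diagram $(2n+1)$ is a matroid. (c) For every integer $n\ge 2$, the U-independence system of the knot diagram $(2n,2)$ is not a matroid.
   Context: Switching a crossing of a knot diagram means interchanging its over- and under-strands. A set $S$ of crossings of a knot diagram $D$ is an unknotting set for $D$ if simultaneously switching exactly the crossings in $S$ turns $D$ into a diagram of the unknot. The unknotting number $u(D)$ of the diagram $D$ is the minimum size of an unknotting set for $D$. A set $W$ of crossings of $D$ is U-independent if for every non-empty $S\subseteq W$ the set $W\setminus S$ is not an unknotting set; that is, no proper subset of $W$ is an unknotting set ($W$ itself may be one). The U-independence system of $D$ is the pair $(E,I)$, where $E$ is the set of all crossings of $D$ and $I$ is the family of all U-independent subsets of $E$. An independence system $(E,I)$ (a finite set $E$ with a non-empty family $I$ of subsets of $E$ closed under taking subsets) is a matroid if it satisfies the exchange property: for any two maximal members $M_1,M_2$ of $I$ and every $x\in M_1$ there exists $y\in M_2$ such that $(M_1\setminus\{x\})\cup\{y\}$ is also a maximal member of $I$. Conway notation: for non-zero integers $c_1,\dots,c_j$, the diagram $(c_1,\dots,c_j)$ with $|c_1|+\dots+|c_j|$ crossings is built as follows. A horizontal row of $c$ half-twists consists of $|c|$ crossings of two strands in a row, at each of which the over-strand has positive slope if $c>0$ and negative slope if $c<0$. Start with a horizontal row of $c_1$ half-twists (a tangle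 with four ends NW, NE, SW, SE). For $i=2,\dots,j$ successively, reflect the current tangle in its NW–SE diagonal (keeping over-strands over) and then attach a horizontal row of $c_i$ half-twists on its right, joining the NE and SE ends to the two left ends of the row. Finally join the NW end to the NE end and the SW end to the SE end by simple arcs. If all $c_i>0$ the diagram is alternating. The knot with Conway notation $(c_1,\dots,c_j)$ is the knot represented by this diagram. In particular $(2n+1)$ is the standard alternating closed 2-strand twist diagram with $2n+1$ crossings. The diagram $D_n$ in (a) is the diagram $(-2,2,-2,2,\dots,-2,2,\,2n+1)$, in which the pair $-2,2$ occurs $n$ times. It has $6n+1$ crossings and represents the same knot as $(2n+1,1,2n)$, whose minimal alternating diagram has $4n+2$ crossings and unknotting number $n+1$. So $D_n$ is not the minimal diagram. *)

theory Defs
  imports "HOL-Library.Multiset"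
begin

section \<open>Diagrams\<close>

text \<open>
  Diagrams are planar-diagram codes. The labels are the edges of the diagram, i.e. the pieces into
  which crossings and some auxiliary bivalent points cut the strands. \<open>Crossing a b c d\<close> is a
  crossing at which the edges \<open>a, b, c, d\<close> arrive in counterclockwise order, \<open>a\<close> and \<open>c\<close> being the
  two ends of the under-strand and \<open>b\<close> and \<open>d\<close> those of the over-strand. \<open>Arc a b\<close> is a crossingless
  simple arc joining an end of \<open>a\<close> to an end of \<open>b\<close>. Strands are not oriented. Diagrams live on the
  sphere; for knots this gives the same notions as diagrams in the plane.

  A diagram is a list of pieces, so that its crossings are named by their positions in the list.
  Reidemeister moves do not need these names and act on the underlying multiset.
\<close>

datatype 'e piece = Arc 'e 'e | is_crossing: Crossing 'e 'e 'e 'e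

type_synonym diagram = "nat piece list"

definition labels :: "'e piece multiset \<Rightarrow> 'e set" where
  "labels T = (\<Union>p\<in>set_mset T. set_piece p)"

definition relabel :: "('e \<Rightarrow> 'f) \<Rightarrow> 'e piece multiset \<Rightarrow> 'f piece multiset" where
  "relabel f T = image_mset (map_piece f) T"

text \<open>
  \<open>planar_tangle T es\<close>: the pieces \<open>T\<close> form a tangle diagram in a disc whose ends, read
  counterclockwise along the boundary of the disc, are \<open>es\<close>. Every such diagram arises from single
  arcs and single crossings by placing discs side by side and joining ends that are adjacent on
  the boundary: cutting an edge next to the outer region of the disc undoes a joining, and when no edge
  is left to cut, only arcs and crossings attached to the boundary remain. A label occurs twice in
  \<open>T\<close> if it is an inner edge and once if it is an end.
\<close>

inductive planar_tangle :: "nat piece multiset \<Rightarrow> nat list \<Rightarrow> bool" where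
  arc: "distinct [a, b] \<Longrightarrow> planar_tangle {#Arc a b#} [a, b]"
| crossing: "distinct [a, b, c, d] \<Longrightarrow> planar_tangle {#Crossing a b c d#} [a, b, c, d]"
| rotate: "planar_tangle T (e # es) \<Longrightarrow> planar_tangle T (es @ [e])"
| juxtapose: "planar_tangle T es \<Longrightarrow> planar_tangle U fs \<Longrightarrow> labels T \<inter> labels U = {}
    \<Longrightarrow> planar_tangle (T + U) (es @ fs)"
| join: "planar_tangle T (a # b # es) \<Longrightarrow> planar_tangle (relabel (id(b := a)) T) es"

definition planar_diagram :: "nat piece multiset \<Rightarrow> bool" where
  "planar_diagram D \<longleftrightarrow> planar_tangle D []"


section \<open>Reidemeister moves and the unknot\<close>

text \<open>
  The first four rules do not change the drawing, only its encoding. In \<open>R1_left\<close>, \<open>R1_right\<close> a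
  kink of either kind is added. In \<open>R2\<close> the disc has the ends \<open>a, b, c, d\<close> in counterclockwise order
  from the lower left, and the strand from \<open>a\<close> to \<open>d\<close> is pushed over the one from \<open>b\<close> to \<open>c\<close>. In the
  two versions of \<open>R3\<close> the disc has the ends \<open>a\<^sub>1, \<dots>, a\<^sub>6\<close> in counterclockwise order, and the strand
  from \<open>a\<^sub>3\<close> to \<open>a\<^sub>6\<close> is moved over the crossing of the strands from \<open>a\<^sub>1\<close> to \<open>a\<^sub>4\<close> and from \<open>a\<^sub>2\<close> to
  \<open>a\<^sub>5\<close>. All other configurations of these moves are obtained by rotating the disc.

  The rules are local rewritings of codes; they are only applied between planar diagrams, see
  \<open>isotopic\<close>. Planarity makes each label occur exactly twice, hence the inner edges of the local
  picture occur nowhere else. The bigon in \<open>R2\<close> and the triangles in \<open>R3\<close> are then faces of the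
  diagram, so the rewriting takes place in a disc. (Applied without the planarity
  condition, \<open>R2\<close> could cross two strands that do not lie on a common face.)
\<close>

inductive move :: "nat piece multiset \<Rightarrow> nat piece multiset \<Rightarrow> bool" where
  rename: "inj_on f (labels D) \<Longrightarrow> move D (relabel f D)"
| flip: "move (R + {#Arc a b#}) (R + {#Arc b a#})"
| half_turn: "move (R + {#Crossing a b c d#}) (R + {#Crossing c d a b#})"
| subdivide: "a \<noteq> b \<Longrightarrow> move (relabel (id(b := a)) R) (R + {#Arc a b#})"
| R1_left: "move (R + {#Arc a b#}) (R + {#Crossing x x a b#})"
| R1_right: "move (R + {#Arc a b#}) (R + {#Crossing a x x b#})"
| R2: "move (R + {#Arc a d, Arc b c#}) (R + {#Crossing b y x a, Crossing x y c d#})"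
| R3_first_under:
    "move (R + {#Crossing a\<^sub>1 a\<^sub>2 p q, Crossing p a\<^sub>3 a\<^sub>4 r, Crossing q r a\<^sub>5 a\<^sub>6#})
          (R + {#Crossing p q a\<^sub>4 a\<^sub>5, Crossing a\<^sub>2 a\<^sub>3 q r, Crossing a\<^sub>1 r p a\<^sub>6#})"
| R3_second_under:
    "move (R + {#Crossing a\<^sub>2 p q a\<^sub>1, Crossing p a\<^sub>3 a\<^sub>4 r, Crossing q r a\<^sub>5 a\<^sub>6#})
          (R + {#Crossing q a\<^sub>4 a\<^sub>5 p, Crossing a\<^sub>2 a\<^sub>3 q r, Crossing a\<^sub>1 r p a\<^sub>6#})"

definition isotopic :: "nat piece multiset \<Rightarrow> nat piece multiset \<Rightarrow> bool" where
  "isotopic = equivclp (\<lambda>D D'. planar_diagram D \<and> planar_diagram D' \<and> move D D')"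

text \<open>\<open>{#Arc 0 0#}\<close> is a simple closed curve without crossings.\<close>

definition is_unknot :: "diagram \<Rightarrow> bool" where
  "is_unknot D \<longleftrightarrow> isotopic (mset D) {#Arc 0 0#}"


section \<open>Crossing switches and the U-independence system\<close>

definition crossings :: "diagram \<Rightarrow> nat set" where
  "crossings D = {i. i < length D \<and> is_crossing (D ! i)}"

fun switch_piece :: "'e piece \<Rightarrow> 'e piece" where
  "switch_piece (Arc a b) = Arc a b"
| "switch_piece (Crossing a b c d) = Crossing b c d a"

definition switch :: "nat set \<Rightarrow> diagram \<Rightarrow> diagram" where
  "switch S D = map (\<lambda>i. if i \<in> S then switch_piece (D ! i) else D ! i) [0..<length D]"

definition unknotting_set :: "diagram \<Rightarrow> nat set \<Rightarrow> bool" where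
  "unknotting_set D S \<longleftrightarrow> S \<subseteq> crossings D \<and> is_unknot (switch S D)"

definition U_independent :: "diagram \<Rightarrow> nat set \<Rightarrow> bool" where
  "U_independent D W \<longleftrightarrow> W \<subseteq> crossings D \<and>
     (\<forall>S. S \<noteq> {} \<and> S \<subseteq> W \<longrightarrow> \<not> unknotting_set D (W - S))"

definition U_independence_system :: "diagram \<Rightarrow> nat set \<times> nat set set" where
  "U_independence_system D = (crossings D, {W. U_independent D W})"


section \<open>Independence systems and matroids\<close>

definition independence_system :: "'a set \<times> 'a set set \<Rightarrow> bool" where
  "independence_system = (\<lambda>(E, I). finite E \<and> I \<noteq> {} \<and> (\<forall>X\<in>I. X \<subseteq> E) \<and>
     (\<forall>X\<in>I. \<forall>Y. Y \<subseteq> X \<longrightarrow> Y \<in> I))"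

definition maximal_member :: "'a set set \<Rightarrow> 'a set \<Rightarrow> bool" where
  "maximal_member I M \<longleftrightarrow> M \<in> I \<and> (\<forall>X\<in>I. M \<subseteq> X \<longrightarrow> X = M)"

definition exchange_property :: "'a set set \<Rightarrow> bool" where
  "exchange_property I \<longleftrightarrow> (\<forall>M\<^sub>1 M\<^sub>2. maximal_member I M\<^sub>1 \<and> maximal_member I M\<^sub>2 \<longrightarrow>
     (\<forall>x\<in>M\<^sub>1. \<exists>y\<in>M\<^sub>2. maximal_member I ((M\<^sub>1 - {x}) \<union> {y})))"

definition matroid :: "'a set \<times> 'a set set \<Rightarrow> bool" where
  "matroid = (\<lambda>(E, I). independence_system (E, I) \<and> exchange_property I)"

text \<open>So a U-independence system can fail to be a matroid only by violating the exchange property.\<close>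

lemma independence_system_U: "independence_system (U_independence_system D)"
proof -
  have sub: "U_independent D Y" if W: "U_independent D W" and Y: "Y \<subseteq> W" for W Y
  proof -
    have "\<not> unknotting_set D (Y - S)" if "S \<noteq> {}" "S \<subseteq> Y" for S
    proof -
      have "W - (S \<union> (W - Y)) = Y - S"
        using Y by blast
      moreover have "S \<union> (W - Y) \<noteq> {} \<and> S \<union> (W - Y) \<subseteq> W"
        using that Y by blast
      ultimately show ?thesis
        using W[unfolded U_independent_def, THEN conjunct2, rule_format, of "S \<union> (W - Y)"] by simp
    qed
    then show ?thesis
      using W Y by (simp add: U_independent_def subset_trans[of Y W])
  qed
  have fin: "finite (crossings D)"
    by (simp add: crossings_def)
  have empty: "U_independent D {}"
    by (simp add: U_independent_def)
  have carrier: "W \<subseteq> crossings D" if "U_independent D W" for W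
    using that by (simp add: U_independent_def)
  show ?thesis
    unfolding independence_system_def U_independence_system_def prod.case
    using sub fin empty carrier by blast
qed


section \<open>Conway notation\<close>

datatype four_tangle =
  Four_Tangle (pieces: "nat piece list") (NW: nat) (NE: nat) (SW: nat) (SE: nat)

text \<open>
  Attaches one crossing on the right: it has the old \<open>ne\<close>, \<open>se\<close> as its left ends and the new labels
  \<open>k\<close>, \<open>k + 1\<close> as its upper right and lower right ends. The over-strand has positive slope iff
  \<open>pos\<close>. The label \<open>k\<close> is fresh since a start tangle uses the labels \<open>0, 1\<close> and each crossing
  adds two.
\<close>

fun attach_crossing :: "bool \<Rightarrow> four_tangle \<Rightarrow> four_tangle" where
  "attach_crossing pos (Four_Tangle ps nw ne sw se) =
     (let k = 2 * length ps + 2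
      in Four_Tangle
           (ps @ [if pos then Crossing (k + 1) k ne se else Crossing se (k + 1) k ne])
           nw k sw (k + 1))"

definition attach_row :: "int \<Rightarrow> four_tangle \<Rightarrow> four_tangle" where
  "attach_row c T = (attach_crossing (c > 0) ^^ nat \<bar>c\<bar>) T"

text \<open>
  The reflection in the NW-SE diagonal of the plane exchanges the NE and SW ends and reverses the cyclic
  order at each crossing, but keeps over-strands over.
\<close>

fun reflect_piece :: "'e piece \<Rightarrow> 'e piece" where
  "reflect_piece (Arc a b) = Arc a b"
| "reflect_piece (Crossing a b c d) = Crossing a d c b"

fun reflect :: "four_tangle \<Rightarrow> four_tangle" where
  "reflect (Four_Tangle ps nw ne sw se) = Four_Tangle (map reflect_piece ps) nw sw ne se"

text \<open>Two horizontal strands; attaching a row to it yields that row.\<close>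

definition horizontal_strands :: four_tangle where
  "horizontal_strands = Four_Tangle [] 0 0 1 1"

fun conway_tangle :: "int list \<Rightarrow> four_tangle" where
  "conway_tangle [] = horizontal_strands"
| "conway_tangle (c # cs) =
     foldl (\<lambda>T c'. attach_row c' (reflect T)) (attach_row c horizontal_strands) cs"

definition conway_diagram :: "int list \<Rightarrow> diagram" where
  "conway_diagram cs =
     (let T = conway_tangle cs in pieces T @ [Arc (NW T) (NE T), Arc (SW T) (SE T)])"

definition D_diagram :: "nat \<Rightarrow> diagram" where
  "D_diagram n = conway_diagram (concat (replicate n [-2, 2]) @ [2 * int n + 1])"

end

theory Submission
  imports Defs
begin

text \<open>
  A diagram in Conway notation with some crossings switched is described by a word that says, crossing by
  crossing, which sign is attached and when the tangle is reflected. Two adjacent crossings of opposite sign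
  cancel by a move \<open>R2\<close>, two successive reflections cancel, and a row without its neighbour unwinds by
  moves \<open>R1\<close>. This unknots \<open>(2n + 1)\<close> after \<open>n\<close> switches, \<open>(2n, 2)\<close> after one switch in the second row,
  and \<open>D\<^sub>n\<close> after switching one crossing in each of its \<open>n\<close> rows \<open>2\<close>, which leaves a single row of
  \<open>2n\<close> negative and \<open>2n + 1\<close> positive crossings.

  Conversely, Fox colourings show that a diagram is knotted. A colouring is determined by the colours of the
  two strands at the start of the word, a row of signed length \<open>s\<close> adds \<open>s\<close> times the difference of its
  left ends to both ends on the right, and the final arcs give a nontrivial colouring modulo the resulting
  determinant. For \<open>D\<^sub>n\<close> with the signed length \<open>s\<close> of the last row this is
  \<open>2n + s (2n + 1)\<close>, so that no set of at most \<open>n\<close> crossings of the last row is unknotting.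

  Since the maximal members of a matroid have the same size, a U-independent set larger than some
  unknotting set rules out a matroid; such sets consist of \<open>n + 1\<close> crossings of the last row of \<open>D\<^sub>n\<close> and of
  two crossings of the first row of \<open>(2n, 2)\<close>. In \<open>(2n + 1)\<close> the U-independent sets are the sets of size
  at most \<open>n\<close>.
\<close>


section \<open>Planar tangles\<close>

lemma labels_simps [simp]:
  "labels {#} = {}"
  "labels (add_mset p T) = set_piece p \<union> labels T"
  "labels (T + U) = labels T \<union> labels U"
  by (auto simp: labels_def)

lemma labels_relabel [simp]: "labels (relabel f T) = f ` labels T"
  by (auto simp: labels_def relabel_def piece.set_map)

lemma finite_labels [simp]: "finite (labels T)"
proof -
  have "finite (set_piece p)" for p :: "'a piece"
    by (cases p) auto
  then show ?thesis
    by (auto simp: labels_def)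
qed

lemma relabel_simps [simp]:
  "relabel f {#} = {#}"
  "relabel f (add_mset p T) = add_mset (map_piece f p) (relabel f T)"
  "relabel f (T + U) = relabel f T + relabel f U"
  by (auto simp: relabel_def)

lemma relabel_relabel: "relabel f (relabel g T) = relabel (f \<circ> g) T"
  by (simp add: relabel_def multiset.map_comp comp_def piece.map_comp)

lemma relabel_cong: "(\<And>x. x \<in> labels T \<Longrightarrow> f x = g x) \<Longrightarrow> relabel f T = relabel g T"
  unfolding relabel_def labels_def by (intro image_mset_cong piece.map_cong0) auto

lemma relabel_ident: "(\<And>x. x \<in> labels T \<Longrightarrow> f x = x) \<Longrightarrow> relabel f T = T"
  using relabel_cong[of T f id] by (simp add: relabel_def piece.map_id0)

lemma relabel_fresh [simp]: "b \<notin> labels T \<Longrightarrow> relabel (id(b := a)) T = T"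
  by (rule relabel_ident) auto

section \<open>Counting the occurrences of labels\<close>

fun piece_labels :: "'e piece \<Rightarrow> 'e multiset" where
  "piece_labels (Arc a b) = {#a, b#}"
| "piece_labels (Crossing a b c d) = {#a, b, c, d#}"

definition occurrences :: "'e piece multiset \<Rightarrow> 'e multiset" where
  "occurrences T = \<Sum>\<^sub># (image_mset piece_labels T)"

lemma occurrences_simps [simp]:
  "occurrences {#} = {#}"
  "occurrences (add_mset p T) = piece_labels p + occurrences T"
  "occurrences (T + U) = occurrences T + occurrences U"
  by (auto simp: occurrences_def)

lemma set_piece_labels: "set_mset (piece_labels p) = set_piece p"
  by (cases p) auto

lemma set_occurrences [simp]: "set_mset (occurrences T) = labels T"
  by (induction T) (auto simp: set_piece_labels)

lemma occurrences_relabel: "occurrences (relabel f T) = image_mset f (occurrences T)"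
proof (induction T)
  case (add p T)
  then show ?case by (cases p) auto
qed simp

text \<open>Joining merges two labels that occur once each into one that occurs twice and is no
  longer an end; the other rules leave the counts alone. That every label of a planar diagram occurs
  exactly twice is what keeps the inner edges of a local move out of the rest of the
  diagram.\<close>

lemma planar_tangle_occurrences:
  assumes "planar_tangle T es"
  shows "distinct es \<and> set es \<subseteq> labels T \<and>
    (\<forall>x\<in>labels T. count (occurrences T) x = (if x \<in> set es then 1 else 2))"
  using assms
proof (induction rule: planar_tangle.induct)
  case (juxtapose T es U fs)
  have "x \<notin> labels U \<Longrightarrow> count (occurrences U) x = 0" "x \<notin> labels T \<Longrightarrow> count (occurrences T) x = 0"
    for x by (simp_all flip: set_occurrences add: not_in_iff)
  with juxtapose show ?case by (auto; blast)
next
  case (join T a b es)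
  let ?f = "id(b := a)"
  have count: "count (image_mset ?f (occurrences T)) x =
      (if x = a then 2 else if x = b then 0 else count (occurrences T) x)" for x
  proof -
    have "count (image_mset ?f N) x =
      (if x = b then (if a = b then count N a else 0) else if x = a then count N a + count N b else count N x)" for N
      by (induction N) auto
    then show ?thesis using join.IH by auto
  qed
  show ?case
    using join.IH by (auto simp: occurrences_relabel count)
qed auto

lemma planar_diagram_occurrences:
  "planar_diagram D \<Longrightarrow> x \<in> labels D \<Longrightarrow> count (occurrences D) x = 2"
  using planar_tangle_occurrences[of D "[]"] by (simp add: planar_diagram_def)

section \<open>Symmetries of planar tangles: rotation, renaming, reflection, half turns\<close>

lemma planar_tangle_rotate: "planar_tangle T (es @ fs) \<Longrightarrow> planar_tangle T (fs @ es)"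
proof (induction es arbitrary: fs)
  case (Cons e es)
  from planar_tangle.rotate[of T e "es @ fs"] Cons.prems have "planar_tangle T (es @ (fs @ [e]))"
    by simp
  from Cons.IH[OF this] show ?case by simp
qed simp

lemma obtain_fresh:
  assumes "finite X"
  obtains x :: nat where "x \<notin> X"
  using ex_new_if_finite[OF infinite_UNIV_nat assms] by blast

lemma planar_tangle_relabel:
  "planar_tangle T es \<Longrightarrow> inj_on f (labels T) \<Longrightarrow> planar_tangle (relabel f T) (map f es)"
proof (induction arbitrary: f rule: planar_tangle.induct)
  case (arc a b)
  then show ?case by (auto intro!: planar_tangle.arc simp: inj_on_def)
next
  case (crossing a b c d)
  then show ?case by (auto intro!: planar_tangle.crossing simp: inj_on_def)
next
  case (rotate T e es)
  have "planar_tangle (relabel f T) (f e # map f es)"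
    using rotate.IH[OF rotate.prems] by simp
  from planar_tangle.rotate[OF this] show ?case by simp
next
  case (juxtapose T es U fs)
  have "inj_on f (labels T)" "inj_on f (labels U)"
    using juxtapose.prems by (auto simp: inj_on_Un)
  moreover have "f ` labels T \<inter> f ` labels U = {}"
    using juxtapose.prems juxtapose.hyps(3) by (force simp: inj_on_def)
  ultimately have "planar_tangle (relabel f T + relabel f U) (map f es @ map f fs)"
    by (intro planar_tangle.juxtapose juxtapose.IH) simp_all
  then show ?case by simp
next
  case (join T a b es)
  have ab: "a \<noteq> b" "a \<notin> set es" "b \<notin> set es" "a \<in> labels T" "b \<in> labels T" "set es \<subseteq> labels T"
    using planar_tangle_occurrences[OF join.hyps] by auto
  \<comment> \<open>After the join \<open>b\<close> is no longer a label, so \<open>f b\<close> may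
    collide with the image of another label. Sending \<open>b\<close> to a fresh \<open>z\<close>
    restores injectivity for the induction hypothesis, and the new join then erases
    \<open>z\<close>.\<close>
  obtain z where z: "z \<notin> f ` labels T"
    by (rule obtain_fresh[of "f ` labels T"]) auto
  define h where "h = f(b := z)"
  have inj: "inj_on f (labels T - {b})"
    by (rule inj_on_subset[OF join.prems]) (auto simp: image_iff)
  have "inj_on h (labels T)"
    using inj z unfolding h_def inj_on_def by auto
  from join.IH[OF this] have "planar_tangle (relabel h T) (h a # h b # map h es)"
    by simp
  moreover have "map h es = map f es" "h a = f a" "h b = z"
    using ab by (auto simp: h_def)
  ultimately have "planar_tangle (relabel h T) (f a # z # map f es)"
    by simp
  from planar_tangle.join[OF this]
  have "planar_tangle (relabel (id(z := f a)) (relabel h T)) (map f es)" .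
  moreover have "relabel (id(z := f a)) (relabel h T) = relabel f (relabel (id(b := a)) T)"
    unfolding relabel_relabel using z by (intro relabel_cong) (auto simp: h_def)
  ultimately show ?case by simp
qed

lemma reflect_piece_map: "reflect_piece (map_piece f p) = map_piece f (reflect_piece p)"
  by (cases p) auto

lemma set_reflect_piece [simp]: "set_piece (reflect_piece p) = set_piece p"
  by (cases p) auto

lemma reflect_reflect_piece [simp]: "reflect_piece (reflect_piece p) = p"
  by (cases p) auto

lemma labels_reflect [simp]: "labels (image_mset reflect_piece T) = labels T"
  by (auto simp: labels_def)

lemma relabel_reflect:
  "relabel f (image_mset reflect_piece T) = image_mset reflect_piece (relabel f T)"
  by (simp add: relabel_def multiset.map_comp comp_def reflect_piece_map)

lemma planar_tangle_reflect:
  "planar_tangle T es \<Longrightarrow> planar_tangle (image_mset reflect_piece T) (rev es)"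
proof (induction rule: planar_tangle.induct)
  case (arc a b)
  then show ?case using planar_tangle.rotate[OF planar_tangle.arc[of a b]] by simp
next
  case (crossing a b c d)
  then show ?case
    using planar_tangle.rotate[OF planar_tangle.crossing[of a d c b]] by auto
next
  case (rotate T e es)
  then show ?case using planar_tangle_rotate[of _ "rev es" "[e]"] by simp
next
  case (juxtapose T es U fs)
  then have "planar_tangle (image_mset reflect_piece T + image_mset reflect_piece U) (rev es @ rev fs)"
    by (intro planar_tangle.juxtapose) auto
  from planar_tangle_rotate[OF this] show ?case by simp
next
  case (join T a b es)
  let ?T = "image_mset reflect_piece T"
  have ab: "a \<noteq> b" "a \<notin> set es" "b \<notin> set es"
    using planar_tangle_occurrences[OF join.hyps] by auto
  \<comment> \<open>Reflection reverses the order of the ends, so the join keeps the name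
    \<open>b\<close> instead of \<open>a\<close>. A renaming, injective because \<open>a\<close> is
    gone, brings \<open>a\<close> back.\<close>
  have "planar_tangle ?T (b # a # rev es)"
    using join.IH planar_tangle_rotate[of ?T "rev es" "[b, a]"] by simp
  from planar_tangle.join[OF this] have "planar_tangle (relabel (id(a := b)) ?T) (rev es)" .
  then have "planar_tangle (relabel (id(b := a)) (relabel (id(a := b)) ?T)) (map (id(b := a)) (rev es))"
    by (rule planar_tangle_relabel) (auto simp: inj_on_def)
  moreover have "map (id(b := a)) (rev es) = rev es"
    using ab by (auto intro: map_idI)
  moreover have "relabel (id(b := a)) (relabel (id(a := b)) ?T) = relabel (id(b := a)) ?T"
    unfolding relabel_relabel by (rule relabel_cong) auto
  ultimately show ?case
    by (simp add: relabel_reflect)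
qed

text \<open>Both symmetries of the code of a piece at once: reversing an arc and turning a crossing by
  a half turn.\<close>

fun turn_piece :: "'e piece \<Rightarrow> 'e piece" where
  "turn_piece (Arc a b) = Arc b a"
| "turn_piece (Crossing a b c d) = Crossing c d a b"

lemma turn_piece_map: "turn_piece (map_piece f p) = map_piece f (turn_piece p)"
  by (cases p) auto

lemma set_turn_piece [simp]: "set_piece (turn_piece p) = set_piece p"
  by (cases p) auto

lemma turn_turn_piece [simp]: "turn_piece (turn_piece p) = p"
  by (cases p) auto

text \<open>A single arc or crossing sits in its disc in the same way after a half turn, up to
  rotating the ends; for the other rules the piece is traced back to the tangle it comes
  from.\<close>

lemma planar_tangle_turn:
  "planar_tangle T es \<Longrightarrow> T = add_mset p R \<Longrightarrow> planar_tangle (add_mset (turn_piece p) R) es"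
proof (induction arbitrary: p R rule: planar_tangle.induct)
  case (arc a b)
  then show ?case using planar_tangle.rotate[OF planar_tangle.arc[of b a]] by auto
next
  case (crossing a b c d)
  then show ?case
    using planar_tangle_rotate[of "{#Crossing c d a b#}" "[c, d]" "[a, b]"]
      planar_tangle.crossing[of c d a b] by auto
next
  case (rotate T e es)
  from planar_tangle.rotate[OF rotate.IH[OF rotate.prems]] show ?case .
next
  case (juxtapose T es U fs)
  from juxtapose.prems have "p \<in># T + U" by simp
  then consider R' where "T = add_mset p R'" | R' where "U = add_mset p R'"
    by (auto dest: multi_member_split)
  then show ?case
  proof cases
    case 1
    from juxtapose.IH(1)[OF 1] juxtapose.hyps 1
    have "planar_tangle (add_mset (turn_piece p) R' + U) (es @ fs)"
      by (intro planar_tangle.juxtapose) auto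
    then show ?thesis using juxtapose.prems 1 by simp
  next
    case 2
    from juxtapose.IH(2)[OF 2] juxtapose.hyps 2
    have "planar_tangle (T + add_mset (turn_piece p) R') (es @ fs)"
      by (intro planar_tangle.juxtapose) auto
    then show ?thesis using juxtapose.prems 2 by simp
  qed
next
  case (join T a b es)
  from join.prems have "p \<in># relabel (id(b := a)) T" by simp
  then obtain q where q: "q \<in># T" "p = map_piece (id(b := a)) q"
    by (auto simp: relabel_def)
  then obtain R' where R': "T = add_mset q R'" by (auto dest: multi_member_split)
  from planar_tangle.join[OF join.IH[OF R']] show ?case
    using join.prems q R' by (auto simp: turn_piece_map)
qed

section \<open>Attaching arcs to the ends of a tangle\<close>

lemma planar_tangle_arc_end:
  assumes "planar_tangle T (b # es)" "k \<notin> labels T"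
  shows "planar_tangle (add_mset (Arc b k) T) (k # es)"
proof -
  \<comment> \<open>The arc enters as a separate tangle with a fresh first end \<open>z\<close>,
    which is then joined to \<open>b\<close>.\<close>
  obtain z where z: "z \<notin> insert k (labels T)"
    by (rule obtain_fresh[of "insert k (labels T)"]) auto
  have b: "b \<in> labels T" using planar_tangle_occurrences[OF assms(1)] by auto
  have "planar_tangle (T + {#Arc z k#}) ((es @ [b]) @ [z, k])"
    using z assms by (intro planar_tangle.juxtapose planar_tangle.rotate planar_tangle.arc) auto
  then have "planar_tangle (T + {#Arc z k#}) (b # z # k # es)"
    using planar_tangle_rotate[of _ es "[b, z, k]"] by simp
  from planar_tangle.join[OF this] show ?thesis
    using z assms(2) b by auto
qed

lemma planar_tangle_close:
  assumes "planar_tangle T (a # b # es)"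
  shows "planar_tangle (add_mset (Arc a b) T) es"
proof -
  obtain k where k: "k \<notin> labels T"
    by (rule obtain_fresh[of "labels T"]) auto
  have ab: "a \<noteq> b" "a \<in> labels T" "b \<in> labels T" "k \<noteq> a" "k \<noteq> b"
    using planar_tangle_occurrences[OF assms] k by auto
  have "planar_tangle (add_mset (Arc a k) T) (k # b # es)"
    using planar_tangle_arc_end[OF assms k] .
  \<comment> \<open>A join keeps the first of the two names; interchanging \<open>k\<close> and
    \<open>b\<close> beforehand makes \<open>b\<close> survive.\<close>
  then have "planar_tangle (relabel (id(k := b, b := k)) (add_mset (Arc a k) T)) (map (id(k := b, b := k)) (k # b # es))"
    by (intro planar_tangle_relabel) (auto simp: inj_on_def)
  then have "planar_tangle (relabel (id(k := b)) (relabel (id(k := b, b := k)) (add_mset (Arc a k) T)))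
      (map (id(k := b, b := k)) es)"
    using planar_tangle.join[of "relabel (id(k := b, b := k)) (add_mset (Arc a k) T)" b k] ab by simp
  moreover have "map (id(k := b, b := k)) es = es"
    using planar_tangle_occurrences[OF assms] k by (intro map_idI) auto
  moreover have "relabel (id(k := b)) (relabel (id(k := b, b := k)) (add_mset (Arc a k) T)) = add_mset (Arc a b) T"
    using ab k by (auto simp: relabel_relabel intro!: relabel_ident)
  ultimately show ?thesis by simp
qed


section \<open>Words and their closures\<close>

lemma isotopic_refl [simp]: "isotopic D D"
  by (simp add: isotopic_def)

lemma isotopic_sym: "isotopic D D' \<Longrightarrow> isotopic D' D"
  unfolding isotopic_def by (rule equivclp_sym)

lemma isotopic_trans [trans]: "isotopic D D' \<Longrightarrow> isotopic D' D'' \<Longrightarrow> isotopic D D''"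
  unfolding isotopic_def by (rule equivclp_trans)

lemma isotopic_move: "move D D' \<Longrightarrow> planar_diagram D \<Longrightarrow> planar_diagram D' \<Longrightarrow> isotopic D D'"
  unfolding isotopic_def by (rule r_into_equivclp) simp

lemma planar_diagram_turn:
  "planar_diagram (add_mset p R) \<Longrightarrow> planar_diagram (add_mset (turn_piece p) R)"
  unfolding planar_diagram_def by (rule planar_tangle_turn[OF _ refl])

lemma isotopic_turn:
  assumes "planar_diagram (add_mset p R)"
  shows "isotopic (add_mset p R) (add_mset (turn_piece p) R)"
proof -
  have "move (add_mset p R) (add_mset (turn_piece p) R)"
    using move.flip[of R] move.half_turn[of R] by (cases p) auto
  then show ?thesis
    using isotopic_move assms planar_diagram_turn by blast
qed

text \<open>Lets a configuration be matched with a Reidemeister move whose code agrees with it only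
  up to half turns of crossings and reversals of arcs.\<close>

lemma planar_diagram_turns:
  assumes "list_all2 (\<lambda>p q. q = p \<or> q = turn_piece p) xs ys" "planar_diagram (mset xs + R)"
  shows "planar_diagram (mset ys + R) \<and> isotopic (mset xs + R) (mset ys + R)"
  using assms
proof (induction arbitrary: R rule: list_all2_induct)
  case (Cons p xs q ys)
  have 1: "planar_diagram (mset xs + add_mset q R)" "isotopic (mset (p # xs) + R) (mset xs + add_mset q R)"
    using Cons.prems Cons.hyps planar_diagram_turn isotopic_turn by auto
  from Cons.IH[OF 1(1)] 1(2) show ?case
    using isotopic_trans by auto
qed simp

text \<open>The rule \<open>subdivide\<close> read backwards, which absorbs a simple arc into the
  edge next to it.\<close>

lemma isotopic_subdivide:
  assumes "planar_diagram (add_mset (Arc a b) R)" "planar_diagram (relabel (id(b := a)) R)" "a \<noteq> b"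
  shows "isotopic (add_mset (Arc a b) R) (relabel (id(b := a)) R)"
  using isotopic_sym[OF isotopic_move[OF move.subdivide[OF assms(3), of R]]] assms by simp

lemma isotopic_rename:
  assumes "planar_diagram D" "inj_on f (labels D)"
  shows "isotopic D (relabel f D)"
  using isotopic_move[OF move.rename[OF assms(2)]] assms planar_tangle_relabel[of D "[]" f]
  by (simp add: planar_diagram_def)

text \<open>The piece produced by \<open>attach_crossing\<close>, with both signs under one name. It
  is kept folded below so that relabelling and label bookkeeping need no case distinction on the
  sign.\<close>

fun crossing_piece :: "bool \<Rightarrow> 'e \<Rightarrow> 'e \<Rightarrow> 'e \<Rightarrow> 'e \<Rightarrow> 'e piece" where
  "crossing_piece p ne se k l = (if p then Crossing l k ne se else Crossing se l k ne)"

lemma set_crossing_piece [simp]: "set_piece (crossing_piece p a b c d) = {a, b, c, d}"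
  by auto

lemma map_crossing_piece [simp]:
  "map_piece f (crossing_piece p a b c d) = crossing_piece p (f a) (f b) (f c) (f d)"
  by auto

declare crossing_piece.simps [simp del]

text \<open>A word describes how to build a tangle: \<open>Some p\<close> attaches a crossing, \<open>None\<close> reflects.
  \<open>closure w k M a b c d\<close> applies \<open>w\<close> to the tangle \<open>M\<close> with ends \<open>a, b, c, d\<close> at NW, NE, SW, SE
  and then joins NW to NE and SW to SE; all labels from \<open>k\<close> on must be unused.\<close>

fun closure :: "bool option list \<Rightarrow> nat \<Rightarrow> nat piece multiset \<Rightarrow> nat \<Rightarrow> nat \<Rightarrow> nat \<Rightarrow> nat \<Rightarrow> nat piece multiset" where
  "closure [] k M a b c d = add_mset (Arc a b) (add_mset (Arc c d) M)"
| "closure (Some p # w) k M a b c d =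
     closure w (k + 2) (add_mset (crossing_piece p b d k (k + 1)) M) a k c (k + 1)"
| "closure (None # w) k M a b c d = closure w k (image_mset reflect_piece M) a c b d"

text \<open>What the remaining word does to a piece placed earlier: only the reflections still to
  come act on it, and by \<open>reflections_cases\<close> only their parity counts.\<close>

fun reflections :: "bool option list \<Rightarrow> nat piece \<Rightarrow> nat piece" where
  "reflections [] = id"
| "reflections (Some p # w) = reflections w"
| "reflections (None # w) = reflections w \<circ> reflect_piece"

lemma reflections_cases: "reflections w = id \<or> reflections w = reflect_piece"
proof (induction w)
  case (Cons x w)
  have "reflect_piece \<circ> reflect_piece = (id :: nat piece \<Rightarrow> nat piece)"
    by (simp add: fun_eq_iff)
  with Cons show ?case by (cases x; elim disjE) simp_all
qed simp

lemma closure_add: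
  "closure w k (add_mset p M) a b c d = add_mset (reflections w p) (closure w k M a b c d)"
  by (induction w k M a b c d arbitrary: p rule: closure.induct)
    (simp_all add: add_mset_commute)

text \<open>Fresh labels are handed out consecutively from \<open>k\<close>, so a renaming that
  shifts them all by the same amount just moves the starting value.\<close>

lemma closure_relabel:
  assumes "\<And>i. g (k + i) = k' + i"
  shows "relabel g (closure w k M a b c d) = closure w k' (relabel g M) (g a) (g b) (g c) (g d)"
  using assms
proof (induction w k M a b c d arbitrary: k' rule: closure.induct)
  case (2 p w k M a b c d)
  from 2(2)[of 0] 2(2)[of 1] have "g k = k'" "g (Suc k) = Suc k'" by auto
  moreover have "g (k + 2 + i) = k' + 2 + i" for i
    using 2(2)[of "2 + i"] by (simp add: add.assoc)
  ultimately show ?case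
    using 2(1)[of "k' + 2"] by simp
qed (simp_all add: relabel_reflect)

text \<open>Counterclockwise from the upper left the ends are NW, SW, SE, NE, hence the order
  \<open>a, c, d, b\<close>. The crossing is first placed beside the tangle with fresh left ends,
  which are then joined to \<open>b\<close> and \<open>d\<close>.\<close>

lemma planar_tangle_crossing:
  assumes "planar_tangle M [a, c, d, b]" "k \<notin> labels M" "l \<notin> labels M" "k \<noteq> l"
  shows "planar_tangle (add_mset (crossing_piece p b d k l) M) [a, c, l, k]"
proof -
  have M: "distinct [a, c, d, b]" "{a, b, c, d} \<subseteq> labels M"
    using planar_tangle_occurrences[OF assms(1)] by auto
  obtain y where y: "y \<notin> {k, l} \<union> labels M"
    by (rule obtain_fresh[of "{k, l} \<union> labels M"]) auto
  obtain z where z: "z \<notin> {k, l, y} \<union> labels M"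
    by (rule obtain_fresh[of "{k, l, y} \<union> labels M"]) auto
  have "planar_tangle {#crossing_piece p y z k l#} [y, z, l, k]"
  proof (cases p)
    case True
    have "planar_tangle {#Crossing l k y z#} ([l, k] @ [y, z])"
      using y z assms(4) planar_tangle.crossing[of l k y z] by auto
    from planar_tangle_rotate[OF this] True show ?thesis by (simp add: crossing_piece.simps)
  next
    case False
    have "planar_tangle {#Crossing z l k y#} ([z, l, k] @ [y])"
      using y z assms(4) planar_tangle.crossing[of z l k y] by auto
    from planar_tangle_rotate[OF this] False show ?thesis by (simp add: crossing_piece.simps)
  qed
  then have "planar_tangle (M + {#crossing_piece p y z k l#}) ([a, c, d, b] @ [y, z, l, k])"
    using assms y z by (intro planar_tangle.juxtapose) auto
  then have "planar_tangle (M + {#crossing_piece p y z k l#}) ([b, y, z, l, k] @ [a, c, d])"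
    using planar_tangle_rotate[of _ "[a, c, d]" "[b, y, z, l, k]"] by simp
  from planar_tangle.join[OF this[simplified]]
  have "planar_tangle (M + {#crossing_piece p b z k l#}) ([z, l, k, a, c] @ [d])"
    using M y z assms by auto
  from planar_tangle_rotate[OF this, simplified] have "planar_tangle (add_mset (crossing_piece p b z k l) M) (d # z # [l, k, a, c])"
    by simp
  from planar_tangle.join[OF this]
  have "planar_tangle (add_mset (crossing_piece p b d k l) M) ([l, k] @ [a, c])"
    using M y z assms by (auto split: if_splits)
  from planar_tangle_rotate[OF this] show ?thesis by simp
qed

lemma planar_tangle_one_crossing:
  assumes "distinct [a, c, k, l]"
  shows "planar_tangle {#crossing_piece p a c k l#} [a, c, l, k]"
proof (cases p)
  case True
  have "planar_tangle {#Crossing l k a c#} ([l, k] @ [a, c])"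
    using assms planar_tangle.crossing[of l k a c] by auto
  from planar_tangle_rotate[OF this] True show ?thesis by (simp add: crossing_piece.simps)
next
  case False
  have "planar_tangle {#Crossing c l k a#} ([c, l, k] @ [a])"
    using assms planar_tangle.crossing[of c l k a] by auto
  from planar_tangle_rotate[OF this] False show ?thesis by (simp add: crossing_piece.simps)
qed

lemma planar_closure:
  "planar_tangle M [a, c, d, b] \<Longrightarrow> labels M \<subseteq> {..<k} \<Longrightarrow> planar_diagram (closure w k M a b c d)"
proof (induction w k M a b c d rule: closure.induct)
  case (1 k M a b c d)
  have "planar_tangle M ([a, c, d] @ [b])"
    using 1 by simp
  from planar_tangle_rotate[OF this] have "planar_tangle M (b # a # [c, d])" by simp
  from planar_tangle_close[OF planar_tangle_close[OF this]]
  have "planar_tangle (add_mset (Arc c d) (add_mset (Arc b a) M)) []" .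
  from planar_tangle_turn[OF this, of "Arc b a"] show ?case
    by (simp add: planar_diagram_def add_mset_commute)
next
  case (2 p w k M a b c d)
  have M: "{a, b, c, d} \<subseteq> labels M"
    using planar_tangle_occurrences[OF 2(2)] by auto
  have "k \<notin> labels M" "k + 1 \<notin> labels M" using 2(3) by auto
  then have "planar_diagram (closure w (k + 2) (add_mset (crossing_piece p b d k (k + 1)) M) a k c (k + 1))"
    using M 2(3) by (intro 2(1) planar_tangle_crossing[OF 2(2)]) auto
  then show ?case by simp
next
  case (3 w k M a b c d)
  have "planar_tangle (image_mset reflect_piece M) ([b, d, c] @ [a])"
    using planar_tangle_reflect[OF 3(2)] by simp
  from planar_tangle_rotate[OF this] 3 show ?case by simp
qed

text \<open>Two horizontal strands without arcs on them are not a \<open>planar_tangle\<close>, but become one as soon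
  as a crossing is attached.\<close>

definition near_planar :: "nat piece multiset \<Rightarrow> nat \<Rightarrow> nat \<Rightarrow> nat \<Rightarrow> nat \<Rightarrow> bool" where
  "near_planar M a b c d \<longleftrightarrow> planar_tangle M [a, c, d, b] \<or> M = {#} \<and> a = b \<and> c = d \<and> a \<noteq> c"

lemma near_planar_crossing:
  assumes "near_planar M a b c d" "labels M \<union> {a, b, c, d} \<subseteq> {..<k}" "k \<le> i" "k \<le> j" "i \<noteq> j"
  shows "planar_tangle (add_mset (crossing_piece p b d i j) M) [a, c, j, i]"
proof (cases "M = {#} \<and> a = b \<and> c = d \<and> a \<noteq> c")
  case True
  then show ?thesis using planar_tangle_one_crossing[of b d i j p] assms by auto
next
  case False
  then have "planar_tangle M [a, c, d, b]"
    using assms(1) by (auto simp: near_planar_def)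
  then show ?thesis
    using assms(2-) by (intro planar_tangle_crossing) auto
qed

lemma near_planar_closure:
  assumes "near_planar M a b c d" "labels M \<union> {a, b, c, d} \<subseteq> {..<k}"
  shows "planar_diagram (closure (Some p # w) k M a b c d)"
proof -
  have "planar_tangle (add_mset (crossing_piece p b d k (k + 1)) M) [a, c, k + 1, k]"
    using near_planar_crossing[OF assms] by simp
  moreover have "labels M \<subseteq> {..<k + 2}"
    using assms(2) by force
  ultimately show ?thesis
    using assms(2) by (auto intro!: planar_closure)
qed

text \<open>Closes the gap that removed crossings leave in the numbering of the labels.\<close>

lemma closure_shift:
  assumes "planar_diagram (closure w k M a b c d)" "labels M \<union> {a, b, c, d} \<subseteq> {..<k}"
  shows "isotopic (closure w k M a b c d) (closure w (k + n) M a b c d)"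
proof -
  define f where "f x = (if x < k then x else x + n)" for x
  have "inj_on f (labels (closure w k M a b c d))" by (auto simp: f_def inj_on_def)
  then have "isotopic (closure w k M a b c d) (relabel f (closure w k M a b c d))"
    using assms(1) by (intro isotopic_rename)
  moreover have "relabel f M = M"
    using assms(2) by (auto intro!: relabel_ident simp: f_def)
  then have "relabel f (closure w k M a b c d) = closure w (k + n) M a b c d"
    using assms(2) closure_relabel[of f k "k + n" w M a b c d] by (simp add: f_def)
  ultimately show ?thesis by simp
qed

section \<open>Cancelling neighbouring crossings of opposite sign\<close>

lemma isotopic_R2:
  assumes "planar_diagram (add_mset P (add_mset Q R))"
    and "planar_diagram (add_mset (Arc a d) (add_mset (Arc b c) R))"
    and "P = Crossing b y x a \<or> turn_piece P = Crossing b y x a"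
    and "Q = Crossing x y c d \<or> turn_piece Q = Crossing x y c d"
  shows "isotopic (add_mset P (add_mset Q R)) (add_mset (Arc a d) (add_mset (Arc b c) R))"
proof -
  let ?D = "add_mset (Crossing b y x a) (add_mset (Crossing x y c d) R)"
  have "list_all2 (\<lambda>p q. q = p \<or> q = turn_piece p) [P, Q] [Crossing b y x a, Crossing x y c d]"
    using assms(3,4) by auto
  from planar_diagram_turns[OF this, of R] assms(1)
  have "planar_diagram ?D" "isotopic (add_mset P (add_mset Q R)) ?D"
    by (auto simp: add_mset_commute)
  moreover from this(1) have "isotopic (add_mset (Arc a d) (add_mset (Arc b c) R)) ?D"
    using isotopic_move[OF move.R2[of R a d b c y x]] assms(2) by (simp add: add_mset_commute)
  ultimately show ?thesis
    using isotopic_trans isotopic_sym by blast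
qed

lemma isotopic_turn2:
  assumes "planar_diagram (add_mset p (add_mset q R))"
  shows "isotopic (add_mset p (add_mset q R)) (add_mset (turn_piece p) (add_mset (turn_piece q) R))"
    "planar_diagram (add_mset (turn_piece p) (add_mset (turn_piece q) R))"
  using planar_diagram_turns[of "[p, q]" "[turn_piece p, turn_piece q]" R] assms
  by (simp_all add: add_mset_commute)

text \<open>The two crossings bound a bigon, and since their signs are opposite one strand lies over
  at both. The sign and the parity of the later reflections, given by \<open>f\<close>, decide which
  of four codes of \<open>R2\<close> occurs; in two of them the resulting arcs run from right to
  left and are turned afterwards.\<close>

lemma isotopic_R2_crossing_piece:
  assumes f: "f = id \<or> f = reflect_piece"
    and 1: "planar_diagram (add_mset (f (crossing_piece (\<not> p) k l k' l')) (add_mset (f (crossing_piece p b d k l)) R))"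
    and 2: "planar_diagram (add_mset (Arc b k') (add_mset (Arc d l') R))"
  shows "isotopic (add_mset (f (crossing_piece (\<not> p) k l k' l')) (add_mset (f (crossing_piece p b d k l)) R))
     (add_mset (Arc b k') (add_mset (Arc d l') R))"
proof -
  let ?D = "add_mset (f (crossing_piece (\<not> p) k l k' l')) (add_mset (f (crossing_piece p b d k l)) R)"
  have turned: "planar_diagram (add_mset (Arc k' b) (add_mset (Arc l' d) R))"
    and turn: "isotopic (add_mset (Arc k' b) (add_mset (Arc l' d) R)) (add_mset (Arc b k') (add_mset (Arc d l') R))"
    using isotopic_turn2[OF 2] isotopic_sym by simp_all
  consider "p" "f = id" | "p" "f = reflect_piece" | "\<not> p" "f = id" | "\<not> p" "f = reflect_piece"
    using f by blast
  then show ?thesis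
  proof cases
    case c: 1
    have "isotopic ?D (add_mset (Arc k' b) (add_mset (Arc l' d) R))"
      using isotopic_R2[of "Crossing l l' k' k" "Crossing l k b d" R l' d k' b k l]
        1 turned c by (simp add: crossing_piece.simps add_mset_commute)
    from isotopic_trans[OF this turn] show ?thesis .
  next
    case c: 2
    then show ?thesis
      using isotopic_R2[of "Crossing l d b k" "Crossing l k k' l'" R d l' b k' k l]
        1 2 by (simp add: crossing_piece.simps add_mset_commute)
  next
    case c: 3
    then show ?thesis
      using isotopic_R2[of "Crossing d l k b" "Crossing l' k' k l" R b k' d l' l k]
        1 2 by (simp add: crossing_piece.simps add_mset_commute)
  next
    case c: 4
    have "isotopic ?D (add_mset (Arc k' b) (add_mset (Arc l' d) R))"
      using isotopic_R2[of "Crossing l' l k k'" "Crossing d b k l" R k' b l' d l k]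
        1 turned c by (simp add: crossing_piece.simps add_mset_commute)
    from isotopic_trans[OF this turn] show ?thesis .
  qed
qed

lemma reflections_arc [simp]: "reflections w (Arc a b) = Arc a b"
  using reflections_cases[of w] by auto

text \<open>The move \<open>R2\<close> erases the edges \<open>k\<close> and \<open>k + 1\<close>
  and leaves arcs to \<open>k + 2\<close> and \<open>k + 3\<close>, which are absorbed one after the
  other; fresh labels still start at \<open>k + 4\<close> at the end. Planarity of the diagrams
  passed on the way is supplied in \<open>isotopic_cancel\<close>.\<close>

lemma isotopic_cancel_aux:
  assumes lab: "labels M \<union> {a, b, c, d} \<subseteq> {..<k}"
    and D1: "planar_diagram (closure (Some p # Some (\<not> p) # w) k M a b c d)"
    and D2: "planar_diagram (closure w (k + 4) (add_mset (Arc b (k + 2)) (add_mset (Arc d (k + 3)) M)) a (k + 2) c (k + 3))"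
    and D3: "planar_diagram (closure w (k + 4) (add_mset (Arc d (k + 3)) M) a b c (k + 3))"
    and D4: "planar_diagram (closure w (k + 4) M a b c d)"
  shows "isotopic (closure (Some p # Some (\<not> p) # w) k M a b c d) (closure w (k + 4) M a b c d)"
proof -
  have M: "relabel (id(k + 2 := b)) M = M" "relabel (id(k + 3 := d)) M = M"
    using lab by (auto intro!: relabel_fresh)
  let ?R = "closure w (k + 4) M a (k + 2) c (k + 3)"
  have "closure (Some p # Some (\<not> p) # w) k M a b c d =
      add_mset (reflections w (crossing_piece (\<not> p) k (k + 1) (k + 2) (k + 3)))
        (add_mset (reflections w (crossing_piece p b d k (k + 1))) ?R)"
    by (simp add: closure_add numeral_eq_Suc)
  moreover have "closure w (k + 4) (add_mset (Arc b (k + 2)) (add_mset (Arc d (k + 3)) M)) a (k + 2) c (k + 3) =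
      add_mset (Arc b (k + 2)) (add_mset (Arc d (k + 3)) ?R)"
    by (simp add: closure_add)
  ultimately have "isotopic (closure (Some p # Some (\<not> p) # w) k M a b c d)
    (closure w (k + 4) (add_mset (Arc b (k + 2)) (add_mset (Arc d (k + 3)) M)) a (k + 2) c (k + 3))"
    using isotopic_R2_crossing_piece[OF reflections_cases] D1 D2 by presburger
  also have "isotopic \<dots> (closure w (k + 4) (add_mset (Arc d (k + 3)) M) a b c (k + 3))"
  proof -
    let ?R = "closure w (k + 4) (add_mset (Arc d (k + 3)) M) a (k + 2) c (k + 3)"
    have 1: "closure w (k + 4) (add_mset (Arc b (k + 2)) (add_mset (Arc d (k + 3)) M)) a (k + 2) c (k + 3) =
        add_mset (Arc b (k + 2)) ?R"
      using closure_add by simp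
    have 2: "relabel (id(k + 2 := b)) ?R = closure w (k + 4) (add_mset (Arc d (k + 3)) M) a b c (k + 3)"
      using closure_relabel[of "id(k + 2 := b)" "k + 4" "k + 4"] lab M(1) by simp
    show ?thesis
      using isotopic_subdivide[of b "k + 2" ?R] D2 D3 lab unfolding 1 2 by simp
  qed
  also have "isotopic \<dots> (closure w (k + 4) M a b c d)"
  proof -
    let ?R = "closure w (k + 4) M a b c (k + 3)"
    have 1: "closure w (k + 4) (add_mset (Arc d (k + 3)) M) a b c (k + 3) = add_mset (Arc d (k + 3)) ?R"
      using closure_add by simp
    have 2: "relabel (id(k + 3 := d)) ?R = closure w (k + 4) M a b c d"
      using closure_relabel[of "id(k + 3 := d)" "k + 4" "k + 4"] lab M(2) by simp
    show ?thesis
      using isotopic_subdivide[of d "k + 3" ?R] D3 D4 lab unfolding 1 2 by simp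
  qed
  finally show ?thesis .
qed


section \<open>Unknotting by Reidemeister moves\<close>

lemma planar_tangle_arc_SE:
  assumes "planar_tangle M [a, c, d, b]" "j \<notin> labels M"
  shows "planar_tangle (add_mset (Arc d j) M) [a, c, j, b]"
proof -
  have "planar_tangle M ([a, c] @ [d, b])" using assms by simp
  from planar_tangle_rotate[OF this] have "planar_tangle M (d # [b, a, c])" by simp
  from planar_tangle_arc_end[OF this assms(2)]
  have "planar_tangle (add_mset (Arc d j) M) ([j, b] @ [a, c])" by simp
  from planar_tangle_rotate[OF this] show ?thesis by simp
qed

lemma planar_tangle_arc_NE:
  assumes "planar_tangle M [a, c, d, b]" "i \<notin> labels M"
  shows "planar_tangle (add_mset (Arc b i) M) [a, c, d, i]"
proof -
  have "planar_tangle M ([a, c, d] @ [b])" using assms by simp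
  from planar_tangle_rotate[OF this] have "planar_tangle M (b # [a, c, d])" by simp
  from planar_tangle_arc_end[OF this assms(2)]
  have "planar_tangle (add_mset (Arc b i) M) ([i] @ [a, c, d])" by simp
  from planar_tangle_rotate[OF this] show ?thesis by simp
qed

lemma near_planar_arcs:
  assumes "near_planar M a b c d" "labels M \<union> {a, b, c, d} \<subseteq> {..<k}" "k \<le> i" "k \<le> j" "i \<noteq> j"
  shows "planar_tangle (add_mset (Arc b i) (add_mset (Arc d j) M)) [a, c, j, i]"
proof (cases "M = {#} \<and> a = b \<and> c = d \<and> a \<noteq> c")
  case True
  have "planar_tangle {#Arc b i#} ([b] @ [i])"
    using assms by (auto intro: planar_tangle.arc)
  from planar_tangle_rotate[OF this] have "planar_tangle {#Arc b i#} [i, b]" by simp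
  then have "planar_tangle ({#Arc b i#} + {#Arc d j#}) ([i, b] @ [d, j])"
    using assms True by (intro planar_tangle.juxtapose planar_tangle.arc) auto
  then have "planar_tangle {#Arc b i, Arc d j#} ([i] @ [b, d, j])"
    by (simp add: add_mset_commute)
  from planar_tangle_rotate[OF this] True show ?thesis by simp
next
  case False
  then have M: "planar_tangle M [a, c, d, b]"
    using assms(1) by (auto simp: near_planar_def)
  have fresh: "i \<notin> labels M" "j \<notin> labels M" "i \<noteq> d"
    using assms by auto
  show ?thesis
    using planar_tangle_arc_NE[OF planar_tangle_arc_SE[OF M fresh(2)]] fresh assms(5) by simp
qed

lemma near_planar_arc_closure:
  assumes "near_planar M a b c d" "labels M \<union> {a, b, c, d} \<subseteq> {..<k}"
    and "planar_tangle M [a, c, d, b] \<or> (\<exists>q v. w = Some q # v)" "k \<le> j" "j < k'"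
  shows "planar_diagram (closure w k' (add_mset (Arc d j) M) a b c j)"
proof (cases "planar_tangle M [a, c, d, b]")
  case True
  then show ?thesis
    using assms by (intro planar_closure planar_tangle_arc_SE) force+
next
  case False
  then have M: "M = {#}" "a = b" "c = d" "a \<noteq> c" using assms(1) by (auto simp: near_planar_def)
  \<comment> \<open>For bare strands the upper one still carries no piece, so a planar tangle only
    arises once the crossing of the next letter is attached; the arc is then put on its lower left
    end.\<close>
  from False assms(3) obtain q v where w: "w = Some q # v" by auto
  have "planar_tangle {#crossing_piece q a j k' (k' + 1)#} ([a] @ [j, k' + 1, k'])"
    using planar_tangle_one_crossing[of a j k' "k' + 1" q] assms by auto
  from planar_tangle_rotate[OF this]
  have "planar_tangle {#crossing_piece q a j k' (k' + 1)#} (j # [k' + 1, k', a])" by simp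
  from planar_tangle_arc_end[OF this, of c]
  have "planar_tangle {#Arc j c, crossing_piece q a j k' (k' + 1)#} (c # [k' + 1, k', a])"
    using assms M by auto
  from planar_tangle_turn[OF this refl]
  have "planar_tangle {#Arc c j, crossing_piece q a j k' (k' + 1)#} ([c, k' + 1, k'] @ [a])"
    by simp
  from planar_tangle_rotate[OF this]
  show ?thesis
    using assms M w by (auto intro!: planar_closure simp: add_mset_commute)
qed

lemma isotopic_cancel:
  assumes "near_planar M a b c d" "labels M \<union> {a, b, c, d} \<subseteq> {..<k}"
    and "planar_tangle M [a, c, d, b] \<or> (\<exists>q v. w = Some q # v)"
  shows "isotopic (closure (Some p # Some (\<not> p) # w) k M a b c d) (closure w k M a b c d)"
proof -
  have "labels M \<union> {a, b, c, d} \<subseteq> {..<k'}" if "k \<le> k'" for k'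
    using assms(2) that by force
  then have planar: "planar_diagram (closure w k' M a b c d)" if "k \<le> k'" for k'
    using assms near_planar_closure[OF assms(1)] planar_closure[of M a c d b k' w] that by auto
  have "isotopic (closure (Some p # Some (\<not> p) # w) k M a b c d) (closure w (k + 4) M a b c d)"
  proof (rule isotopic_cancel_aux[OF assms(2)])
    show "planar_diagram (closure (Some p # Some (\<not> p) # w) k M a b c d)"
      using assms(1,2) by (rule near_planar_closure)
    have "labels M \<subseteq> {..<k + 4}" using assms(2) by force
    then show "planar_diagram (closure w (k + 4) (add_mset (Arc b (k + 2)) (add_mset (Arc d (k + 3)) M)) a (k + 2) c (k + 3))"
      using assms(2) near_planar_arcs[OF assms(1,2), of "k + 2" "k + 3"] by (auto intro!: planar_closure)
    show "planar_diagram (closure w (k + 4) (add_mset (Arc d (k + 3)) M) a b c (k + 3))"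
      using assms by (rule near_planar_arc_closure) auto
  qed (use planar in simp)
  also have "isotopic (closure w (k + 4) M a b c d) (closure w k M a b c d)"
    using closure_shift[of w k M a b c d 4] planar[of k] assms(2) isotopic_sym by auto
  finally show ?thesis .
qed

text \<open>The prefix \<open>u\<close> is absorbed into the tangle letter by letter until the
  cancelling pair stands directly at its right.\<close>

lemma isotopic_cancel_in_planar:
  assumes "planar_tangle M [a, c, d, b]" "labels M \<subseteq> {..<k}"
  shows "isotopic (closure (u @ Some p # Some (\<not> p) # w) k M a b c d) (closure (u @ w) k M a b c d)"
  using assms
proof (induction u k M a b c d rule: closure.induct)
  case (1 k M a b c d)
  then have "{a, b, c, d} \<subseteq> labels M"
    using planar_tangle_occurrences[OF 1(1)[simplified]] by auto
  with 1 show ?case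
    by (auto intro!: isotopic_cancel simp: near_planar_def simp del: closure.simps)
next
  case (2 q u k M a b c d)
  have M: "{a, b, c, d} \<subseteq> labels M"
    using planar_tangle_occurrences[OF 2(2)] by auto
  have "k \<notin> labels M" "k + 1 \<notin> labels M" using 2(3) by auto
  from planar_tangle_crossing[OF 2(2) this, of q]
  have "planar_tangle (add_mset (crossing_piece q b d k (k + 1)) M) [a, c, k + 1, k]" by simp
  moreover have "labels (add_mset (crossing_piece q b d k (k + 1)) M) \<subseteq> {..<k + 2}"
    using M 2(3) by auto
  ultimately show ?case using 2(1) by simp
next
  case (3 u k M a b c d)
  have "planar_tangle (image_mset reflect_piece M) ([b, d, c] @ [a])"
    using planar_tangle_reflect[OF 3(2)] by simp
  from planar_tangle_rotate[OF this] 3 show ?case by simp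
qed

abbreviation strands_closure :: "bool option list \<Rightarrow> nat piece multiset" where
  "strands_closure w \<equiv> closure w 2 {#} 0 0 1 1"

lemma near_planar_strands: "near_planar {#} 0 0 1 1"
  by (simp add: near_planar_def)

lemma planar_tangle_first_crossing:
  "planar_tangle {#crossing_piece p 0 (Suc 0) 2 3#} [0, Suc 0, 3, 2]"
  using planar_tangle_one_crossing[of 0 "Suc 0" 2 3] by simp

lemma planar_strands_closure: "planar_diagram (strands_closure (Some p # w))"
  by (rule near_planar_closure[OF near_planar_strands]) simp

text \<open>Bare strands form no planar tangle, so a crossing must remain at the start of the word:
  either \<open>u\<close> supplies it, or \<open>u\<close> is empty and \<open>w\<close>
  does.\<close>

lemma isotopic_cancel_strands:
  assumes "\<exists>q v. u @ w = Some q # v"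
  shows "isotopic (strands_closure (u @ Some p # Some (\<not> p) # w)) (strands_closure (u @ w))"
proof (cases u)
  case Nil
  then show ?thesis
    using isotopic_cancel[OF near_planar_strands, of 2 w p] assms by (simp del: closure.simps)
next
  case (Cons x u')
  with assms obtain q where "u = Some q # u'" by auto
  then show ?thesis
    using isotopic_cancel_in_planar[of "{#crossing_piece q 0 (Suc 0) 2 3#}" 0 "Suc 0" 3 2 4 u']
      planar_tangle_first_crossing[of q] by (auto simp: numeral_eq_Suc)
qed

section \<open>Closures that unwind to a circle\<close>

lemma planar_circle: "planar_diagram {#Arc x x#}"
  using planar_tangle.join[OF planar_tangle.arc[of x "Suc x"]] by (simp add: planar_diagram_def)

lemma isotopic_circle: "isotopic {#Arc x x#} {#Arc 0 0#}"
  using isotopic_rename[OF planar_circle, of "\<lambda>_. 0" x] by simp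

text \<open>Absorbing the two closing arcs leaves a circle with one kink, which
  \<open>R1_right\<close> removes.\<close>

lemma isotopic_one_crossing: "isotopic (strands_closure [Some True]) {#Arc 0 0#}"
proof -
  have "planar_tangle {#Crossing 3 2 0 1#} ([3] @ [2, 0, 1])"
    using planar_tangle.crossing[of 3 2 0 1] by simp
  from planar_tangle.join[OF planar_tangle_rotate[OF this, simplified]]
  have 1: "planar_tangle {#Crossing 3 2 2 1#} ([1] @ [3])"
    by simp
  have D2: "planar_diagram {#Arc 1 3, Crossing 3 2 2 1#}"
    using planar_tangle_close[of _ 1 3 "[]"] 1 by (simp add: planar_diagram_def)
  have D3: "planar_diagram {#Crossing 1 2 2 1#}"
    using planar_tangle.join[of _ 1 3 "[]"] 1 by (force simp: planar_diagram_def)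
  have D0: "planar_diagram {#Arc 0 2, Arc 1 3, Crossing 3 2 0 1#}"
    using planar_strands_closure[of True "[]"] by (simp add: crossing_piece.simps numeral_eq_Suc)
  have "strands_closure [Some True] = {#Arc 0 2, Arc 1 3, Crossing 3 2 0 1#}"
    by (simp add: crossing_piece.simps numeral_eq_Suc)
  also have "isotopic \<dots> {#Arc 2 0, Arc 1 3, Crossing 3 2 0 1#}"
    using isotopic_turn[OF D0] by simp
  also have "isotopic \<dots> {#Arc 1 3, Crossing 3 2 2 1#}"
    using isotopic_subdivide[of 2 0 "{#Arc 1 3, Crossing 3 2 0 1#}"] D2 planar_diagram_turn[OF D0] by simp
  also have "isotopic \<dots> {#Crossing 1 2 2 1#}"
    using isotopic_subdivide[of 1 3 "{#Crossing 3 2 2 1#}"] D2 D3 by simp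
  also have "isotopic \<dots> {#Arc 1 1#}"
    using isotopic_sym[OF isotopic_move[OF move.R1_right[of "{#}" 1 1 2]]] planar_circle[of 1] D3 by simp
  also note isotopic_circle
  finally show ?thesis .
qed

definition signed_length :: "bool list \<Rightarrow> int" where
  "signed_length w = (\<Sum>p\<leftarrow>w. if p then 1 else - 1)"

lemma signed_length_simps [simp]:
  "signed_length [] = 0"
  "signed_length (p # w) = (if p then 1 else - 1) + signed_length w"
  "signed_length (u @ w) = signed_length u + signed_length w"
  by (simp_all add: signed_length_def)

lemma signed_length_replicate [simp]: "signed_length (replicate n p) = (if p then int n else - int n)"
  by (induction n) auto

text \<open>Drives the induction in \<open>isotopic_row\<close>: while both signs occur, some
  neighbouring pair cancels.\<close>

lemma constant_or_change:
  "(\<exists>u p v. w = u @ p # (\<not> p) # v) \<or> (\<exists>p. w = replicate (length w) p)"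
proof (induction w)
  case (Cons x w)
  show ?case
  proof (cases "\<exists>u p v. w = u @ p # (\<not> p) # v")
    case True
    then obtain u p v where "x # w = (x # u) @ p # (\<not> p) # v" by auto
    then show ?thesis by blast
  next
    case False
    with Cons obtain p where p: "w = replicate (length w) p" by auto
    show ?thesis
    proof (cases "w = [] \<or> p = x")
      case True
      then have "x # w = replicate (length (x # w)) x" using p by auto
      then show ?thesis by blast
    next
      case False
      then have "x # w = [] @ x # (\<not> x) # tl w"
        using p by (cases w) auto
      then show ?thesis by blast
    qed
  qed
qed simp

lemma isotopic_row:
  assumes "signed_length w = 1"
  shows "isotopic (strands_closure (map Some w)) {#Arc 0 0#}"
  using assms
proof (induction w rule: length_induct)
  case IH: (1 w)
  from constant_or_change[of w]
  consider u p v where "w = u @ p # (\<not> p) # v" | p where "w = replicate (length w) p" by blast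
  then show ?case
  proof cases
    case (1 u p v)
    then have sum: "signed_length (u @ v) = 1" using IH(2) by (auto split: if_splits)
    \<comment> \<open>Signed length 1 forces a crossing to survive, as cancellation on bare strands
      requires.\<close>
    then have "u @ v \<noteq> []" by auto
    then obtain q z where "u @ v = q # z" by (meson neq_Nil_conv)
    then have "map Some u @ map Some v = Some q # map Some z"
      by (metis list.simps(9) map_append)
    then have "isotopic (strands_closure (map Some w)) (strands_closure (map Some (u @ v)))"
      using isotopic_cancel_strands[of "map Some u" "map Some v" p] 1 by (auto simp del: closure.simps)
    also have "isotopic \<dots> {#Arc 0 0#}"
      using IH(1)[rule_format, OF _ sum] 1 by simp
    finally show ?thesis .
  next
    case (2 p)
    with IH(2) have "w = [True]"
      using signed_length_replicate[of "length w" p] by (cases p) auto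
    then show ?thesis using isotopic_one_crossing by simp
  qed
qed

text \<open>The reflection turns the NE end \<open>k\<close> into the SW end, so a closing arc joins
  the two right ends \<open>k\<close> and \<open>k + 1\<close> of the last crossing and makes it a
  kink. For a negative crossing \<open>R1_left\<close> yields the arc in the opposite direction, and
  it is flipped.\<close>

lemma isotopic_R1_reflected:
  assumes "near_planar M a b c d" "labels M \<union> {a, b, c, d} \<subseteq> {..<k}"
  shows "isotopic (closure [Some p, None] k M a b c d) (closure [None] k M a b c d)"
proof -
  let ?M = "image_mset reflect_piece M"
  let ?x = "if p then Crossing k d b k else Crossing d b k k"
  have fresh: "k + 1 \<notin> labels M" "k + 1 \<notin> {a, b, c, d}" using assms(2) by auto
  have eq: "closure [Some p, None] k M a b c d =
    add_mset (Arc k (k + 1)) (add_mset (Arc a c) (add_mset (reflect_piece (crossing_piece p b d k (k + 1))) ?M))"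
    by (simp add: add_mset_commute)
  have D0: "planar_diagram (closure [Some p, None] k M a b c d)"
    using near_planar_closure[OF assms] by blast
  have "planar_tangle (add_mset (crossing_piece p b d k (k + 1)) M) [a, c, k + 1, k]"
    using near_planar_crossing[OF assms] by simp
  from planar_tangle.join[OF planar_tangle_reflect[OF this, simplified]]
  have "planar_tangle (add_mset ?x ?M) [c, a]"
    using fresh by (auto simp: crossing_piece.simps)
  from planar_tangle_turn[OF planar_tangle_close[OF this] refl]
  have D1: "planar_diagram (add_mset (Arc a c) (add_mset ?x ?M))"
    by (simp add: planar_diagram_def)
  have D2: "planar_diagram (add_mset (Arc b d) (add_mset (Arc a c) ?M))"
  proof (cases "planar_tangle M [a, c, d, b]")
    case True
    then show ?thesis
      using planar_closure[of M a c d b k "[None]"] assms by (simp add: add_mset_commute)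
  next
    case False
    then show ?thesis
      using assms planar_tangle_close[OF planar_tangle.arc[of a c]]
      by (auto simp: near_planar_def planar_diagram_def)
  qed
  have swap: "add_mset (Arc a c) (add_mset ?x ?M) = add_mset ?x (add_mset (Arc a c) ?M)"
    by (rule add_mset_commute)
  let ?R = "add_mset (Arc a c) (add_mset (reflect_piece (crossing_piece p b d k (k + 1))) ?M)"
  have "relabel (id(k + 1 := k)) ?R = add_mset (Arc a c) (add_mset ?x ?M)"
    using fresh by (simp add: crossing_piece.simps)
  then have "isotopic (closure [Some p, None] k M a b c d) (add_mset (Arc a c) (add_mset ?x ?M))"
    using isotopic_subdivide[of k "k + 1" ?R] D0 D1 unfolding eq by simp
  also have "isotopic \<dots> (add_mset (turn_piece ?x) (add_mset (Arc a c) ?M))"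
    unfolding swap by (rule isotopic_turn[OF D1[unfolded swap]])
  also have "isotopic \<dots> (add_mset (Arc b d) (add_mset (Arc a c) ?M))"
  proof -
    have D3: "planar_diagram (add_mset (turn_piece ?x) (add_mset (Arc a c) ?M))"
      by (rule planar_diagram_turn[OF D1[unfolded swap]])
    show ?thesis
    proof (cases p)
      case True
      then show ?thesis
        using isotopic_sym[OF isotopic_move[OF move.R1_right[of "add_mset (Arc a c) ?M" b d k]]] D2 D3 by simp
    next
      case False
      have "planar_diagram (add_mset (Arc d b) (add_mset (Arc a c) ?M))"
        "isotopic (add_mset (Arc d b) (add_mset (Arc a c) ?M)) (add_mset (Arc b d) (add_mset (Arc a c) ?M))"
        using planar_diagram_turn[OF D2] isotopic_sym[OF isotopic_turn[OF D2]] by simp_all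
      then show ?thesis
        using isotopic_sym[OF isotopic_move[OF move.R1_left[of "add_mset (Arc a c) ?M" d b k]]] D3 False
        by (auto intro: isotopic_trans)
    qed
  qed
  finally show ?thesis by (simp add: add_mset_commute)
qed

lemma isotopic_R1_row:
  assumes "near_planar M a b c d" "labels M \<union> {a, b, c, d} \<subseteq> {..<k}"
  shows "isotopic (closure (map Some w @ [Some p, None]) k M a b c d) (closure (map Some w @ [None]) k M a b c d)"
  using assms
proof (induction w arbitrary: k M a b c d)
  case Nil
  then show ?case using isotopic_R1_reflected by simp
next
  case (Cons q w)
  let ?M = "add_mset (crossing_piece q b d k (k + 1)) M"
  have "planar_tangle ?M [a, c, k + 1, k]"
    using near_planar_crossing[OF Cons.prems] by simp
  moreover have "labels ?M \<union> {a, k, c, k + 1} \<subseteq> {..<k + 2}"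
    using Cons.prems(2) by force
  ultimately show ?case
    using Cons.IH[of ?M a k c "k + 1" "k + 2"] by (simp add: near_planar_def)
qed

text \<open>A row followed by a final reflection unwinds from its last crossing on, whatever its
  signs.\<close>

lemma isotopic_vertical_row: "isotopic (strands_closure (map Some w @ [None])) {#Arc 0 0#}"
proof (induction w rule: rev_induct)
  case Nil
  have "planar_diagram {#Arc 0 (1::nat), Arc 0 1#}"
    using planar_tangle_close[OF planar_tangle.arc[of 0 1]] by (simp add: planar_diagram_def)
  then show ?case
    using isotopic_subdivide[of 0 1 "{#Arc 0 1#}"] planar_circle[of 0] by simp
next
  case (snoc p w)
  have "isotopic (strands_closure (map Some w @ [Some p, None])) (strands_closure (map Some w @ [None]))"
    using isotopic_R1_row[OF near_planar_strands] by simp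
  with snoc show ?case using isotopic_trans by auto
qed


section \<open>Fox colourings\<close>

text \<open>Fox colourings modulo \<open>m\<close>. Outside \<open>{0..<m}\<close> the operation is made trivial so that the laws
  of an involutory quandle hold for all integers.\<close>

definition fox :: "int \<Rightarrow> int \<Rightarrow> int \<Rightarrow> int" where
  "fox m x y = (if x \<in> {0..<m} \<and> y \<in> {0..<m} then (2 * y - x) mod m else x)"

lemma fox_idem [simp]: "fox m x x = x"
  by (auto simp: fox_def)

lemma fox_outside: "x \<notin> {0..<m} \<or> y \<notin> {0..<m} \<Longrightarrow> fox m x y = x"
  unfolding fox_def by argo

lemma fox_range: "fox m x y \<in> {0..<m} \<longleftrightarrow> x \<in> {0..<m}"
  by (auto simp: fox_def)

lemma fox_mod: "m > 0 \<Longrightarrow> fox m (x mod m) (y mod m) = (2 * y - x) mod m"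
  by (simp add: fox_def mod_mult_right_eq flip: mod_diff_left_eq[of "2 * (y mod m)"])
    (simp add: mod_diff_eq)

lemma fox_invol [simp]: "fox m (fox m x y) y = x"
proof (cases "x \<in> {0..<m} \<and> y \<in> {0..<m}")
  case True
  then have "(2 * y - (2 * y - x) mod m) mod m = x"
    by (simp add: mod_simps)
  with True fox_range[of m x y] show ?thesis
    by (simp add: fox_def)
qed (auto simp: fox_def)

lemma fox_eq_iff [simp]: "fox m x y = y \<longleftrightarrow> x = y"
  using fox_idem fox_invol by metis

lemma fox_eq_iff' [simp]: "y = fox m x y \<longleftrightarrow> x = y"
  using fox_eq_iff by metis

text \<open>The law behind invariance under \<open>R3\<close>, as \<open>fox_idem\<close> and
  \<open>fox_invol\<close> are behind \<open>R1\<close> and \<open>R2\<close>. With an argument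
  outside \<open>{0..<m}\<close> it holds because \<open>fox\<close> is trivial there and never
  moves an element into or out of this range.\<close>

lemma fox_distrib: "fox m (fox m x y) z = fox m (fox m x z) (fox m y z)"
proof (cases "x \<in> {0..<m} \<and> y \<in> {0..<m} \<and> z \<in> {0..<m}")
  case True
  then have 1: "x = x mod m" "y = y mod m" "z = z mod m" and m: "m > 0" by auto
  have "fox m (fox m (x mod m) (y mod m)) (z mod m) =
      fox m (fox m (x mod m) (z mod m)) (fox m (y mod m) (z mod m))"
    using m by (simp only: fox_mod) (simp add: algebra_simps)
  then show ?thesis using 1 by simp
next
  case False
  then show ?thesis
    using fox_range fox_outside by metis
qed

section \<open>Colourings of diagrams and their invariance\<close>

fun coloured :: "int \<Rightarrow> ('e \<Rightarrow> int) \<Rightarrow> 'e piece \<Rightarrow> bool" where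
  "coloured m f (Arc a b) \<longleftrightarrow> f a = f b"
| "coloured m f (Crossing a b c d) \<longleftrightarrow> f b = f d \<and> f c = fox m (f a) (f b)"

definition colouring :: "int \<Rightarrow> ('e \<Rightarrow> int) \<Rightarrow> 'e piece multiset \<Rightarrow> bool" where
  "colouring m f D \<longleftrightarrow> (\<forall>p\<in>#D. coloured m f p)"

definition colourable :: "int \<Rightarrow> 'e piece multiset \<Rightarrow> bool" where
  "colourable m D \<longleftrightarrow> (\<exists>f. colouring m f D \<and> (\<exists>x\<in>labels D. \<exists>y\<in>labels D. f x \<noteq> f y))"

lemma colouring_simps [simp]:
  "colouring m f {#}"
  "colouring m f (add_mset p D) \<longleftrightarrow> coloured m f p \<and> colouring m f D"
  "colouring m f (D + E) \<longleftrightarrow> colouring m f D \<and> colouring m f E"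
  by (auto simp: colouring_def)

lemma coloured_map: "coloured m f (map_piece g p) \<longleftrightarrow> coloured m (f \<circ> g) p"
  by (cases p) auto

lemma colouring_relabel: "colouring m f (relabel g D) \<longleftrightarrow> colouring m (f \<circ> g) D"
  by (auto simp: colouring_def relabel_def coloured_map)

lemma coloured_cong: "(\<And>x. x \<in> set_piece p \<Longrightarrow> f x = g x) \<Longrightarrow> coloured m f p \<longleftrightarrow> coloured m g p"
  by (cases p) auto

lemma colouring_cong: "(\<And>x. x \<in> labels D \<Longrightarrow> f x = g x) \<Longrightarrow> colouring m f D \<longleftrightarrow> colouring m g D"
  unfolding colouring_def labels_def by (intro ball_cong refl coloured_cong) auto

lemma colourable_relabel_inj:
  assumes "inj_on g (labels D)"
  shows "colourable m (relabel g D) \<longleftrightarrow> colourable m D"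
proof
  assume "colourable m (relabel g D)"
  then obtain f x y where "colouring m (f \<circ> g) D" "x \<in> labels D" "y \<in> labels D" "(f \<circ> g) x \<noteq> (f \<circ> g) y"
    by (auto simp: colourable_def colouring_relabel)
  then show "colourable m D"
    unfolding colourable_def by blast
next
  assume "colourable m D"
  then obtain f x y where f: "colouring m f D" "x \<in> labels D" "y \<in> labels D" "f x \<noteq> f y"
    by (auto simp: colourable_def)
  define h where "h = f \<circ> the_inv_into (labels D) g"
  have h: "(h \<circ> g) x = f x" if "x \<in> labels D" for x
    using the_inv_into_f_f[OF assms that] by (simp add: h_def)
  have "colouring m (h \<circ> g) D"
    using f(1) h colouring_cong[of D "h \<circ> g" f] by blast
  moreover have "h (g x) \<noteq> h (g y)" using f h[of x] h[of y] by simp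
  ultimately show "colourable m (relabel g D)"
    using f unfolding colourable_def colouring_relabel by auto
qed

text \<open>Scheme for \<open>R1\<close>, \<open>R2\<close> and \<open>R3\<close>: a colouring is
  altered at the inner edges \<open>I\<close> only, and if the result is constant on the new
  picture, the original was constant on the old one with the same colour. Hence a nontrivial
  colouring stays nontrivial.\<close>

lemma colourable_local:
  assumes "colourable m (R + L)" "labels R \<inter> I = {}"
    and "\<And>f. colouring m f L \<Longrightarrow> \<exists>f'. colouring m f' L' \<and> (\<forall>x. x \<notin> I \<longrightarrow> f' x = f x) \<and>
      (\<forall>c. (\<forall>x\<in>labels L'. f' x = c) \<longrightarrow> (\<forall>x\<in>labels L. f x = c))"
    and "labels L' \<noteq> {}"
  shows "colourable m (R + L')"
proof -
  obtain f where f: "colouring m f (R + L)" "\<exists>x\<in>labels (R + L). \<exists>y\<in>labels (R + L). f x \<noteq> f y"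
    using assms(1) by (auto simp: colourable_def)
  from f(1) assms(3)[of f] obtain f' where f': "colouring m f' L'" "\<And>x. x \<notin> I \<Longrightarrow> f' x = f x"
    "\<And>c. \<forall>x\<in>labels L'. f' x = c \<Longrightarrow> \<forall>x\<in>labels L. f x = c" by auto
  have R: "f' x = f x" if "x \<in> labels R" for x
    using f'(2) assms(2) that by auto
  then have "colouring m f' R"
    using f(1) colouring_cong[of R f' f] by simp
  moreover have "\<exists>x\<in>labels (R + L'). \<exists>y\<in>labels (R + L'). f' x \<noteq> f' y"
  proof (rule ccontr)
    assume contra: "\<not> ?thesis"
    obtain z where "z \<in> labels L'" using assms(4) by auto
    then have "z \<in> labels (R + L')" by simp
    with contra have const: "\<And>x. x \<in> labels (R + L') \<Longrightarrow> f' x = f' z" by blast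
    then have "\<forall>x\<in>labels L. f x = f' z"
      by (intro f'(3)) simp
    moreover have "\<forall>x\<in>labels R. f x = f' z"
      using const R by simp
    ultimately show False using f(2) by auto
  qed
  ultimately show ?thesis
    using f'(1) by (auto simp: colourable_def)
qed

lemma colourable_subdivide:
  assumes "planar_diagram (add_mset (Arc a b) R)" "a \<noteq> b"
  shows "colourable m (relabel (id(b := a)) R) \<longleftrightarrow> colourable m (add_mset (Arc a b) R)"
proof -
  \<comment> \<open>\<open>b\<close> occurs twice in the diagram but only once in the arc, hence
    also in \<open>R\<close>, so no colour disappears with the arc.\<close>
  have "count (occurrences (add_mset (Arc a b) R)) b = 2"
    by (rule planar_diagram_occurrences[OF assms(1)]) simp
  then have "count (occurrences R) b \<noteq> 0"
    using assms(2) by simp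
  then have b: "b \<in> labels R"
    unfolding set_occurrences[symmetric] by (auto intro: count_inI)
  let ?g = "id(b := a)"
  show ?thesis
  proof
    assume "colourable m (relabel ?g R)"
    then obtain f x y where f: "colouring m (f \<circ> ?g) R" "x \<in> labels R" "y \<in> labels R" "f (?g x) \<noteq> f (?g y)"
      by (auto simp: colourable_def colouring_relabel)
    then have "colouring m (f \<circ> ?g) (add_mset (Arc a b) R)" using assms(2) by simp
    moreover have "x \<in> labels (add_mset (Arc a b) R)" "y \<in> labels (add_mset (Arc a b) R)"
      using f by auto
    ultimately show "colourable m (add_mset (Arc a b) R)"
      using f(4) unfolding colourable_def by (metis comp_apply)
  next
    assume "colourable m (add_mset (Arc a b) R)"
    then obtain f x y where f: "colouring m f (add_mset (Arc a b) R)"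
      "x \<in> labels (add_mset (Arc a b) R)" "y \<in> labels (add_mset (Arc a b) R)" "f x \<noteq> f y"
      by (auto simp: colourable_def)
    have g: "f (?g z) = f z" for z using f(1) by simp
    have "f \<circ> ?g = f" using g by (simp add: fun_eq_iff)
    then have "colouring m f (relabel ?g R)"
      using f(1) by (simp add: colouring_relabel)
    moreover have "\<exists>z'\<in>labels (relabel ?g R). f z' = f z" if "z \<in> labels (add_mset (Arc a b) R)" for z
      using that b g[of z] g[of b] f(1) by (cases "z \<in> {a, b}") (auto simp: image_iff intro!: bexI[of _ z])
    ultimately show "colourable m (relabel ?g R)"
      using f(2-4) unfolding colourable_def by metis
  qed
qed

text \<open>Two occurrences already exhaust what planarity allows, so an inner edge of a local
  picture is used nowhere else.\<close>

lemma planar_inner_label: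
  assumes "planar_diagram (R + L)" "occurrences L = add_mset x (add_mset x N)"
  shows "x \<notin># N" "x \<notin> labels R"
proof -
  have "x \<in> labels (R + L)"
    using assms(2) by (simp flip: set_occurrences)
  from planar_diagram_occurrences[OF assms(1) this] assms(2)
  have "count N x = 0 \<and> count (occurrences R) x = 0" by simp
  then show "x \<notin># N" "x \<notin> labels R"
    by (simp_all flip: set_occurrences add: not_in_iff)
qed

lemma colourable_R1:
  assumes "planar_diagram (R + L')" "L' = {#Crossing x x a b#} \<or> L' = {#Crossing a x x b#}"
  shows "colourable m (R + {#Arc a b#}) \<longleftrightarrow> colourable m (R + L')"
proof -
  have "occurrences L' = add_mset x (add_mset x {#a, b#})"
    using assms(2) by (auto simp: add_mset_commute)
  from planar_inner_label[OF assms(1) this]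
  have x: "x \<noteq> a" "x \<noteq> b" and R: "labels R \<inter> {x} = {}" by auto
  show ?thesis
  proof
    assume "colourable m (R + {#Arc a b#})"
    then show "colourable m (R + L')"
    proof (rule colourable_local[OF _ R])
      fix f assume "colouring m f {#Arc a b#}"
      then show "\<exists>f'. colouring m f' L' \<and> (\<forall>z. z \<notin> {x} \<longrightarrow> f' z = f z) \<and>
          (\<forall>c. (\<forall>x\<in>labels L'. f' x = c) \<longrightarrow> (\<forall>x\<in>labels {#Arc a b#}. f x = c))"
        using assms(2) x by (intro exI[of _ "f(x := f a)"]) auto
    qed (use assms in auto)
  next
    assume "colourable m (R + L')"
    then show "colourable m (R + {#Arc a b#})"
    proof (rule colourable_local[OF _ R])
      fix f assume f: "colouring m f L'"
      \<comment> \<open>At a kink the edge \<open>x\<close> is both an under-end and an over-end,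
        which forces a single colour.\<close>
      have "f a = f x \<and> f b = f x"
        using f assms(2) fox_eq_iff[of m "f a" "f x"] by auto
      then show "\<exists>f'. colouring m f' {#Arc a b#} \<and> (\<forall>z. z \<notin> {x} \<longrightarrow> f' z = f z) \<and>
          (\<forall>c. (\<forall>x\<in>labels {#Arc a b#}. f' x = c) \<longrightarrow> (\<forall>x\<in>labels L'. f x = c))"
        using assms(2) by (intro exI[of _ f]) auto
    qed auto
  qed
qed

lemma colourable_R2:
  assumes "planar_diagram (R + {#Crossing b y x a, Crossing x y c d#})"
  shows "colourable m (R + {#Arc a d, Arc b c#}) \<longleftrightarrow> colourable m (R + {#Crossing b y x a, Crossing x y c d#})"
proof -
  let ?L = "{#Crossing b y x a, Crossing x y c d#}"
  have "occurrences ?L = add_mset x (add_mset x {#y, y, a, b, c, d#})"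
    "occurrences ?L = add_mset y (add_mset y {#x, x, a, b, c, d#})"
    by (simp_all add: add_mset_commute)
  from planar_inner_label[OF assms this(1)] planar_inner_label[OF assms this(2)]
  have x: "x \<noteq> y" "x \<notin> {a, b, c, d}" "y \<notin> {a, b, c, d}" and R: "labels R \<inter> {x, y} = {}" by auto
  show ?thesis
  proof
    assume "colourable m (R + {#Arc a d, Arc b c#})"
    then show "colourable m (R + ?L)"
    proof (rule colourable_local[OF _ R])
      fix f assume "colouring m f {#Arc a d, Arc b c#}"
      then have "f d = f a" "f c = f b" by auto
      then show "\<exists>f'. colouring m f' ?L \<and> (\<forall>z. z \<notin> {x, y} \<longrightarrow> f' z = f z) \<and>
          (\<forall>e. (\<forall>x\<in>labels ?L. f' x = e) \<longrightarrow> (\<forall>x\<in>labels {#Arc a d, Arc b c#}. f x = e))"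
      \<comment> \<open>\<open>y\<close> lies on the strand pushed over and takes the colour of
        \<open>a\<close>; \<open>x\<close> is the part of the lower strand between the two
        crossings.\<close>
      proof (intro exI[of _ "f(y := f a, x := fox m (f b) (f a))"] conjI allI impI ballI)
        fix e z
        assume const: "\<forall>z\<in>labels ?L. (f(y := f a, x := fox m (f b) (f a))) z = e"
          and z: "z \<in> labels {#Arc a d, Arc b c#}"
        have "z \<in> labels ?L" "z \<noteq> x" "z \<noteq> y" using z x by auto
        with bspec[OF const this(1)] show "f z = e" by simp
      qed (use x in simp_all)
    qed auto
  next
    assume "colourable m (R + ?L)"
    then show "colourable m (R + {#Arc a d, Arc b c#})"
    proof (rule colourable_local[OF _ R])
      fix f assume "colouring m f ?L"
      then have e: "f d = f a" "f y = f a" "f c = f b" "f x = fox m (f b) (f a)" by simp_all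
      show "\<exists>f'. colouring m f' {#Arc a d, Arc b c#} \<and> (\<forall>z. z \<notin> {x, y} \<longrightarrow> f' z = f z) \<and>
          (\<forall>e. (\<forall>x\<in>labels {#Arc a d, Arc b c#}. f' x = e) \<longrightarrow> (\<forall>x\<in>labels ?L. f x = e))"
        by (intro exI[of _ f]) (simp add: e)
    qed auto
  qed
qed

lemma colourable_R3:
  assumes "planar_diagram (R + L)"
    and "L = {#Crossing a\<^sub>1 a\<^sub>2 p q, Crossing p a\<^sub>3 a\<^sub>4 r, Crossing q r a\<^sub>5 a\<^sub>6#} \<and>
        L' = {#Crossing p q a\<^sub>4 a\<^sub>5, Crossing a\<^sub>2 a\<^sub>3 q r, Crossing a\<^sub>1 r p a\<^sub>6#} \<or>
      L = {#Crossing a\<^sub>2 p q a\<^sub>1, Crossing p a\<^sub>3 a\<^sub>4 r, Crossing q r a\<^sub>5 a\<^sub>6#} \<and>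
        L' = {#Crossing q a\<^sub>4 a\<^sub>5 p, Crossing a\<^sub>2 a\<^sub>3 q r, Crossing a\<^sub>1 r p a\<^sub>6#}"
  shows "colourable m (R + L) \<longleftrightarrow> colourable m (R + L')"
proof -
  let ?N = "{#a\<^sub>1, a\<^sub>2, a\<^sub>3, a\<^sub>4, a\<^sub>5, a\<^sub>6#}"
  have "occurrences L = {#p, p, q, q, r, r#} + ?N"
    using assms(2) by (elim disjE conjE) (simp_all add: add_mset_commute)
  then have "occurrences L = add_mset p (add_mset p ({#q, q, r, r#} + ?N))"
    "occurrences L = add_mset q (add_mset q ({#p, p, r, r#} + ?N))"
    "occurrences L = add_mset r (add_mset r ({#p, p, q, q#} + ?N))"
    by (simp_all add: add_mset_commute)
  from planar_inner_label[OF assms(1) this(1)] planar_inner_label[OF assms(1) this(2)]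
    planar_inner_label[OF assms(1) this(3)]
  have x: "p \<noteq> q" "p \<noteq> r" "q \<noteq> r" "a\<^sub>1 \<notin> {p, q, r}" "a\<^sub>2 \<notin> {p, q, r}" "a\<^sub>3 \<notin> {p, q, r}"
      "a\<^sub>4 \<notin> {p, q, r}" "a\<^sub>5 \<notin> {p, q, r}" "a\<^sub>6 \<notin> {p, q, r}"
    and R: "labels R \<inter> {p, q, r} = {}" by auto
  have fwd: "\<exists>f'. colouring m f' L' \<and> (\<forall>z. z \<notin> {p, q, r} \<longrightarrow> f' z = f z) \<and>
      (\<forall>c. (\<forall>x\<in>labels L'. f' x = c) \<longrightarrow> (\<forall>x\<in>labels L. f x = c))" if f: "colouring m f L" for f
  \<comment> \<open>After the move the strands from \<open>a\<^sub>1\<close> and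
    \<open>a\<^sub>2\<close> pass under the strand of colour \<open>f a\<^sub>3\<close> before they
    cross each other, which fixes \<open>p\<close> and \<open>q\<close>; \<open>r\<close> stays on
    the over-strand and keeps its colour. The colours at \<open>a\<^sub>4\<close> and
    \<open>a\<^sub>5\<close> then fit by \<open>fox_distrib\<close>.\<close>
  proof (rule exI[of _ "f(p := fox m (f a\<^sub>1) (f a\<^sub>3), q := fox m (f a\<^sub>2) (f a\<^sub>3))"])
    from assms(2) consider
        "L = {#Crossing a\<^sub>1 a\<^sub>2 p q, Crossing p a\<^sub>3 a\<^sub>4 r, Crossing q r a\<^sub>5 a\<^sub>6#}"
        "L' = {#Crossing p q a\<^sub>4 a\<^sub>5, Crossing a\<^sub>2 a\<^sub>3 q r, Crossing a\<^sub>1 r p a\<^sub>6#}"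
      | "L = {#Crossing a\<^sub>2 p q a\<^sub>1, Crossing p a\<^sub>3 a\<^sub>4 r, Crossing q r a\<^sub>5 a\<^sub>6#}"
        "L' = {#Crossing q a\<^sub>4 a\<^sub>5 p, Crossing a\<^sub>2 a\<^sub>3 q r, Crossing a\<^sub>1 r p a\<^sub>6#}" by blast
    then show "colouring m (f(p := fox m (f a\<^sub>1) (f a\<^sub>3), q := fox m (f a\<^sub>2) (f a\<^sub>3))) L' \<and>
      (\<forall>z. z \<notin> {p, q, r} \<longrightarrow> (f(p := fox m (f a\<^sub>1) (f a\<^sub>3), q := fox m (f a\<^sub>2) (f a\<^sub>3))) z = f z) \<and>
      (\<forall>c. (\<forall>x\<in>labels L'. (f(p := fox m (f a\<^sub>1) (f a\<^sub>3), q := fox m (f a\<^sub>2) (f a\<^sub>3))) x = c) \<longrightarrow>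
        (\<forall>x\<in>labels L. f x = c))"
    proof cases
      case 1
      have e: "f q = f a\<^sub>2" "f r = f a\<^sub>3" "f a\<^sub>6 = f a\<^sub>3" "f p = fox m (f a\<^sub>1) (f a\<^sub>2)"
          "f a\<^sub>4 = fox m (fox m (f a\<^sub>1) (f a\<^sub>2)) (f a\<^sub>3)" "f a\<^sub>5 = fox m (f a\<^sub>2) (f a\<^sub>3)"
        using f 1(1) by simp_all
      show ?thesis
        using x fox_distrib[of m "f a\<^sub>1" "f a\<^sub>2" "f a\<^sub>3"] unfolding 1 by (simp add: e)
    next
      case 2
      have e: "f p = f a\<^sub>1" "f r = f a\<^sub>3" "f a\<^sub>6 = f a\<^sub>3" "f q = fox m (f a\<^sub>2) (f a\<^sub>1)"
          "f a\<^sub>5 = fox m (fox m (f a\<^sub>2) (f a\<^sub>1)) (f a\<^sub>3)" "f a\<^sub>4 = fox m (f a\<^sub>1) (f a\<^sub>3)"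
        using f 2(1) by simp_all
      show ?thesis
        using x fox_distrib[of m "f a\<^sub>2" "f a\<^sub>1" "f a\<^sub>3"] unfolding 2 by (simp add: e)
    qed
  qed
  have bwd: "\<exists>f'. colouring m f' L \<and> (\<forall>z. z \<notin> {p, q, r} \<longrightarrow> f' z = f z) \<and>
      (\<forall>c. (\<forall>x\<in>labels L. f' x = c) \<longrightarrow> (\<forall>x\<in>labels L'. f x = c))" if f: "colouring m f L'" for f
  proof -
    from assms(2) consider
        "L = {#Crossing a\<^sub>1 a\<^sub>2 p q, Crossing p a\<^sub>3 a\<^sub>4 r, Crossing q r a\<^sub>5 a\<^sub>6#}"
        "L' = {#Crossing p q a\<^sub>4 a\<^sub>5, Crossing a\<^sub>2 a\<^sub>3 q r, Crossing a\<^sub>1 r p a\<^sub>6#}"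
      | "L = {#Crossing a\<^sub>2 p q a\<^sub>1, Crossing p a\<^sub>3 a\<^sub>4 r, Crossing q r a\<^sub>5 a\<^sub>6#}"
        "L' = {#Crossing q a\<^sub>4 a\<^sub>5 p, Crossing a\<^sub>2 a\<^sub>3 q r, Crossing a\<^sub>1 r p a\<^sub>6#}" by blast
    then show ?thesis
    proof cases
      case 1
      have f': "f q = f a\<^sub>5" "f a\<^sub>4 = fox m (f p) (f q)" "f a\<^sub>3 = f r" "f q = fox m (f a\<^sub>2) (f a\<^sub>3)"
          "f r = f a\<^sub>6" "f p = fox m (f a\<^sub>1) (f r)"
        using f unfolding 1(2) colouring_simps coloured.simps by blast+
      then have e: "f q = fox m (f a\<^sub>2) (f a\<^sub>3)" "f r = f a\<^sub>3" "f a\<^sub>6 = f a\<^sub>3" "f p = fox m (f a\<^sub>1) (f a\<^sub>3)"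
          "f a\<^sub>4 = fox m (fox m (f a\<^sub>1) (f a\<^sub>2)) (f a\<^sub>3)" "f a\<^sub>5 = fox m (f a\<^sub>2) (f a\<^sub>3)"
        using f' fox_distrib by metis+
      \<comment> \<open>Before the move \<open>q\<close> continues the strand from
        \<open>a\<^sub>2\<close>, which is over at its crossing with the strand from
        \<open>a\<^sub>1\<close>, and \<open>p\<close> is the latter after passing under. In the
        other version the roles are exchanged.\<close>
      show ?thesis
        using x unfolding 1
        by (intro exI[of _ "f(p := fox m (f a\<^sub>1) (f a\<^sub>2), q := f a\<^sub>2)"]) (simp add: e)
    next
      case 2
      have f': "f a\<^sub>4 = f p" "f a\<^sub>5 = fox m (f q) (f a\<^sub>4)" "f a\<^sub>3 = f r" "f q = fox m (f a\<^sub>2) (f a\<^sub>3)"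
          "f r = f a\<^sub>6" "f p = fox m (f a\<^sub>1) (f r)"
        using f unfolding 2(2) colouring_simps coloured.simps by blast+
      then have e: "f q = fox m (f a\<^sub>2) (f a\<^sub>3)" "f r = f a\<^sub>3" "f a\<^sub>6 = f a\<^sub>3" "f p = fox m (f a\<^sub>1) (f a\<^sub>3)"
          "f a\<^sub>5 = fox m (fox m (f a\<^sub>2) (f a\<^sub>1)) (f a\<^sub>3)" "f a\<^sub>4 = fox m (f a\<^sub>1) (f a\<^sub>3)"
        using f' fox_distrib by metis+
      show ?thesis
        using x unfolding 2
        by (intro exI[of _ "f(p := f a\<^sub>1, q := fox m (f a\<^sub>2) (f a\<^sub>1))"]) (simp add: e)
    qed
  qed
  have "labels L \<noteq> {}" "labels L' \<noteq> {}" using assms(2) by auto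
  with colourable_local[OF _ R fwd] colourable_local[OF _ R bwd] show ?thesis
    by blast
qed

text \<open>A half turn exchanges the two under-ends, and \<open>fox_invol\<close> makes the
  colouring condition symmetric in them.\<close>

lemma colourable_turn: "colourable m (add_mset p R) \<longleftrightarrow> colourable m (add_mset (turn_piece p) R)"
proof -
  have "coloured m f (turn_piece p) \<longleftrightarrow> coloured m f p" for f
  proof (cases p)
    case (Crossing a b c d)
    then show ?thesis by simp (metis fox_invol)
  qed auto
  then show ?thesis by (auto simp: colourable_def)
qed

lemma colourable_move:
  assumes "move D D'" "planar_diagram D" "planar_diagram D'"
  shows "colourable m D \<longleftrightarrow> colourable m D'"
  using assms
proof (induction rule: move.induct)
  case (rename f D)
  then show ?case using colourable_relabel_inj by blast
next
  case (flip R a b)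
  then show ?case using colourable_turn[of m "Arc a b" R] by simp
next
  case (half_turn R a b c d)
  then show ?case using colourable_turn[of m "Crossing a b c d" R] by simp
next
  case (subdivide a b R)
  then show ?case using colourable_subdivide[of a b R m] by simp
next
  case (R1_left R a b x)
  then show ?case using colourable_R1[of R "{#Crossing x x a b#}"] by blast
next
  case (R1_right R a b x)
  then show ?case using colourable_R1[of R "{#Crossing a x x b#}"] by blast
next
  case (R2 R a d b c y x)
  then show ?case using colourable_R2 by blast
next
  case R3_first_under
  then show ?case by (intro colourable_R3) auto
next
  case R3_second_under
  then show ?case by (intro colourable_R3) auto
qed

lemma colourable_isotopic:
  assumes "isotopic D D'"
  shows "colourable m D \<longleftrightarrow> colourable m D'"
  using assms unfolding isotopic_def
  by (induction rule: equivclp_induct) (auto dest: colourable_move)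

text \<open>The circle has a single label and hence only constant colourings.\<close>

lemma not_isotopic_circle: "colourable m D \<Longrightarrow> \<not> isotopic D {#Arc 0 0#}"
  by (auto dest: colourable_isotopic[of _ _ m] simp: colourable_def)


section \<open>Conway diagrams\<close>

text \<open>Integer lifts of the colours at NW, NE, SW, SE. A crossing shifts both right ends by the
  same amount, so their difference is constant along a row; reduction modulo \<open>m\<close> is
  postponed until the ends are joined.\<close>

fun end_colours :: "bool option list \<Rightarrow> int \<times> int \<times> int \<times> int \<Rightarrow> int \<times> int \<times> int \<times> int" where
  "end_colours [] t = t"
| "end_colours (Some p # w) (\<alpha>, \<beta>, \<gamma>, \<delta>) =
    (let s = (if p then \<delta> - \<beta> else \<beta> - \<delta>) in end_colours w (\<alpha>, \<beta> + s, \<gamma>, \<delta> + s))"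
| "end_colours (None # w) (\<alpha>, \<beta>, \<gamma>, \<delta>) = end_colours w (\<alpha>, \<gamma>, \<beta>, \<delta>)"

lemma end_colours_row:
  "end_colours (map Some w @ v) (\<alpha>, \<beta>, \<gamma>, \<delta>) =
    end_colours v (\<alpha>, \<beta> + signed_length w * (\<delta> - \<beta>), \<gamma>, \<delta> + signed_length w * (\<delta> - \<beta>))"
  by (induction w arbitrary: \<beta> \<delta>) (auto simp: Let_def algebra_simps)

lemma coloured_crossing_piece:
  assumes "m > 0" "F k = F b + s" "F l = F d + s" "s = (if p then F d - F b else F b - F d)"
  shows "coloured m (\<lambda>x. F x mod m) (crossing_piece p b d k l)"
  using assms by (auto simp: crossing_piece.simps fox_mod)

lemma coloured_reflect [simp]: "coloured m f (reflect_piece p) \<longleftrightarrow> coloured m f p"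
  by (cases p) auto

lemma colouring_reflect [simp]: "colouring m f (image_mset reflect_piece M) \<longleftrightarrow> colouring m f M"
  by (auto simp: colouring_def)

text \<open>Each crossing just determines the colours of its two fresh edges, so any start colours
  extend along the word. The only constraints come from the two closing arcs, and these are the two
  divisibilities.\<close>

lemma closure_colouring:
  assumes "m > 0" "colouring m (\<lambda>x. F x mod m) M" "labels M \<union> {a, b, c, d} \<subseteq> {..<k}"
    and "end_colours w (F a, F b, F c, F d) = (\<alpha>, \<beta>, \<gamma>, \<delta>)" "m dvd \<beta> - \<alpha>" "m dvd \<delta> - \<gamma>"
  shows "\<exists>F'. (\<forall>x<k. F' x = F x) \<and> colouring m (\<lambda>x. F' x mod m) (closure w k M a b c d)"
  using assms
proof (induction w k M a b c d arbitrary: F rule: closure.induct)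
  case (1 k M a b c d)
  then have "F a mod m = F b mod m" "F c mod m = F d mod m"
    by (auto simp: mod_eq_dvd_iff dvd_diff_commute)
  with 1 show ?case by auto
next
  case (2 p w k M a b c d)
  define s where "s = (if p then F d - F b else F b - F d)"
  define G where "G = F(k := F b + s, k + 1 := F d + s)"
  let ?M = "add_mset (crossing_piece p b d k (k + 1)) M"
  have lt: "a < k" "b < k" "c < k" "d < k" "\<And>x. x \<in> labels M \<Longrightarrow> x < k"
    using 2(4) by auto
  have G: "G a = F a" "G b = F b" "G c = F c" "G d = F d" "G k = F b + s" "G (k + 1) = F d + s"
    "\<And>x. x < k \<Longrightarrow> G x = F x"
    using lt by (auto simp: G_def)
  have "colouring m (\<lambda>x. G x mod m) M"
    using 2(3) lt(5) G(7) colouring_cong[of M "\<lambda>x. G x mod m" "\<lambda>x. F x mod m"] by simp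
  moreover have "coloured m (\<lambda>x. G x mod m) (crossing_piece p b d k (k + 1))"
    using 2(2) G by (intro coloured_crossing_piece) (auto simp: s_def)
  ultimately have "colouring m (\<lambda>x. G x mod m) ?M" by simp
  moreover have "labels ?M \<union> {a, k, c, k + 1} \<subseteq> {..<k + 2}"
    using lt by fastforce
  moreover have "end_colours w (G a, G k, G c, G (k + 1)) = (\<alpha>, \<beta>, \<gamma>, \<delta>)"
    using 2(5) G by (simp add: s_def Let_def)
  ultimately obtain F' where "\<forall>x<k + 2. F' x = G x"
    "colouring m (\<lambda>x. F' x mod m) (closure w (k + 2) ?M a k c (k + 1))"
    using 2(1)[of G] 2(2,6,7) by blast
  then show ?case
    using G(7) by (intro exI[of _ F']) simp
next
  case (3 w k M a b c d)
  then show ?case by (simp add: insert_commute)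
qed

text \<open>Ensures that two different start colours really occur in the diagram.\<close>

lemma ends_labels_closure: "{a, b, c, d} \<subseteq> labels (closure w k M a b c d)"
proof (induction w k M a b c d rule: closure.induct)
  case (2 p w k M a b c d)
  then show ?case by (simp add: closure_add)
      (use reflections_cases[of w] in \<open>auto simp del: closure.simps\<close>)
qed auto

text \<open>The start consists of two vertical strands, so that the first row of a Conway notation,
  too, can be preceded by a reflection.\<close>

abbreviation diagram_of_word :: "bool option list \<Rightarrow> nat piece multiset" where
  "diagram_of_word w \<equiv> closure w 2 {#} 0 1 0 1"

lemma not_unknot:
  assumes "m > 1" "end_colours w (0, 1, 0, 1) = (\<alpha>, \<beta>, \<gamma>, \<delta>)" "m dvd \<beta> - \<alpha>" "m dvd \<delta> - \<gamma>"
  shows "\<not> isotopic (diagram_of_word w) {#Arc 0 0#}"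
proof -
  obtain F where F: "\<forall>x<2. F x = int x" "colouring m (\<lambda>x. F x mod m) (diagram_of_word w)"
    using closure_colouring[of m int "{#}" 0 1 0 1 2 w] assms by auto
  have "F 0 mod m \<noteq> F 1 mod m"
    using F(1) assms(1) by simp
  then have "colourable m (diagram_of_word w)"
    using F(2) ends_labels_closure[of 0 1 0 1 w 2 "{#}"] unfolding colourable_def by auto
  then show ?thesis by (rule not_isotopic_circle)
qed

section \<open>Conway diagrams with switched crossings as closures of words\<close>

lemma closure_None_None: "closure (u @ None # None # v) k M a b c d = closure (u @ v) k M a b c d"
  by (induction u k M a b c d rule: closure.induct) (simp_all add: multiset.map_comp comp_def)

fun step :: "bool option \<Rightarrow> four_tangle \<Rightarrow> four_tangle" where
  "step (Some p) T = attach_crossing p T"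
| "step None T = reflect T"

definition conway_word :: "int list \<Rightarrow> bool option list" where
  "conway_word cs = concat (map (\<lambda>c. None # replicate (nat \<bar>c\<bar>) (Some (c > 0))) cs)"

lemma conway_word_simps [simp]:
  "conway_word [] = []"
  "conway_word (c # cs) = None # replicate (nat \<bar>c\<bar>) (Some (c > 0)) @ conway_word cs"
  "conway_word (cs @ ds) = conway_word cs @ conway_word ds"
  by (simp_all add: conway_word_def)

lemma attach_row_step: "attach_row c T = fold step (replicate (nat \<bar>c\<bar>) (Some (c > 0))) T"
proof -
  have "step (Some p) = attach_crossing p" for p
    by (rule ext) simp
  then show ?thesis by (simp add: attach_row_def)
qed

lemma conway_tangle_step:
  assumes "cs \<noteq> []"
  shows "conway_tangle cs = fold step (conway_word cs) (Four_Tangle [] 0 1 0 1)"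
proof -
  have "foldl (\<lambda>T c'. attach_row c' (reflect T)) T cs = fold step (conway_word cs) T" for T cs
    by (induction cs arbitrary: T) (simp_all add: attach_row_step)
  with assms show ?thesis
    by (cases cs) (simp_all add: attach_row_step horizontal_strands_def)
qed

fun switch_word :: "nat set \<Rightarrow> nat \<Rightarrow> bool option list \<Rightarrow> bool option list" where
  "switch_word S i [] = []"
| "switch_word S i (Some p # w) = Some (p \<noteq> (i \<in> S)) # switch_word S (i + 1) w"
| "switch_word S i (None # w) = None # switch_word S i w"

fun twists :: "bool option list \<Rightarrow> nat" where
  "twists [] = 0"
| "twists (Some p # w) = Suc (twists w)"
| "twists (None # w) = twists w"

lemma twists_append [simp]: "twists (u @ v) = twists u + twists v"
  by (induction u rule: twists.induct) auto

lemma twists_replicate [simp]: "twists (replicate n (Some p)) = n"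
  by (induction n) auto

lemma switch_word_append:
  "switch_word S i (u @ v) = switch_word S i u @ switch_word S (i + twists u) v"
  by (induction u arbitrary: i rule: twists.induct) auto

lemma switch_word_ident: "S \<inter> {i..<i + twists w} = {} \<Longrightarrow> switch_word S i w = w"
proof (induction w arbitrary: i rule: twists.induct)
  case (2 p w)
  then have "S \<inter> {i + 1..<(i + 1) + twists w} = {}" "i \<notin> S" by auto
  with 2(1)[of "i + 1"] show ?case by simp
qed auto

lemma switch_word_replicate:
  "switch_word S i (replicate n (Some True)) = map Some (map (\<lambda>j. j \<notin> S) [i..<i + n])"
proof (induction n arbitrary: i)
  case (Suc n)
  then show ?case by (simp add: upt_conv_Cons del: upt_Suc)
qed simp

lemma signed_length_switched: "signed_length (map (\<lambda>j. j \<notin> S) [i..<i + n]) = int n - 2 * int (card (S \<inter> {i..<i + n}))"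
proof (induction n)
  case (Suc n)
  have "S \<inter> {i..<i + Suc n} = (if i + n \<in> S then insert (i + n) (S \<inter> {i..<i + n}) else S \<inter> {i..<i + n})"
    by (auto simp: less_Suc_eq)
  with Suc show ?case by simp
qed simp

text \<open>Switching a positive crossing gives the code of a negative one only up to a half turn,
  and switching commutes with reflection only up to a half turn; hence pieces are compared in this
  weaker sense.\<close>

abbreviation turn_equal :: "'e piece \<Rightarrow> 'e piece \<Rightarrow> bool" where
  "turn_equal p q \<equiv> q = p \<or> q = turn_piece p"

lemma switch_Nil [simp]: "switch S [] = []"
  by (simp add: switch_def)

lemma length_switch [simp]: "length (switch S ps) = length ps"
  by (simp add: switch_def)

lemma switch_append:
  "switch S (ps @ [p]) = switch S ps @ [if length ps \<in> S then switch_piece p else p]"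
  by (auto simp: switch_def nth_append)

lemma turn_equal_reflect:
  "turn_equal (switch_piece p) q \<Longrightarrow> turn_equal (switch_piece (reflect_piece p)) (reflect_piece q)"
  "turn_equal p q \<Longrightarrow> turn_equal (reflect_piece p) (reflect_piece q)"
  by (cases p; auto)+

lemma switch_map_reflect:
  assumes "list_all2 turn_equal (switch S ps) qs"
  shows "list_all2 turn_equal (switch S (map reflect_piece ps)) (map reflect_piece qs)"
  unfolding list_all2_conv_all_nth
proof (intro conjI allI impI)
  show "length (switch S (map reflect_piece ps)) = length (map reflect_piece qs)"
    using list_all2_lengthD[OF assms] by simp
  fix i assume i: "i < length (switch S (map reflect_piece ps))"
  with assms have "turn_equal (switch S ps ! i) (qs ! i)" "i < length qs"
    by (auto simp: list_all2_conv_all_nth)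
  with i show "turn_equal (switch S (map reflect_piece ps) ! i) (map reflect_piece qs ! i)"
    using turn_equal_reflect[where p = "ps ! i" and q = "qs ! i"] by (cases "i \<in> S") (simp_all add: switch_def)
qed

text \<open>The construction is followed letter by letter: building from \<open>w\<close> and then
  switching agrees, up to half turns, with building from the switched word. The label counters of
  \<open>attach_crossing\<close> and \<open>closure\<close> run in parallel, both advancing by 2 per
  crossing.\<close>

lemma fold_step_switch:
  assumes "list_all2 turn_equal (switch S ps) ps'" "\<forall>p\<in>set ps. is_crossing p"
  shows "\<exists>qs qs' nw ne sw se. fold step w (Four_Tangle ps a b c d) = Four_Tangle qs nw ne sw se \<and>
    list_all2 turn_equal (switch S qs) qs' \<and> (\<forall>p\<in>set qs. is_crossing p) \<and>
    length qs = length ps + twists w \<and>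
    closure (switch_word S (length ps) w) (2 * length ps + 2) (mset ps') a b c d =
      mset qs' + {#Arc nw ne, Arc sw se#}"
  using assms
proof (induction w arbitrary: ps ps' a b c d)
  case Nil
  then show ?case by auto
next
  case (Cons x w)
  show ?case
  proof (cases x)
    case None
    have "\<forall>p\<in>set (map reflect_piece ps). is_crossing p"
    proof -
      have "is_crossing (reflect_piece p) = is_crossing p" for p :: "nat piece" by (cases p) auto
      with Cons.prems(2) show ?thesis by simp
    qed
    from Cons.IH[OF switch_map_reflect[OF Cons.prems(1)] this, of a c b d] show ?thesis
      by (simp add: None)
  next
    case (Some p)
    let ?k = "2 * length ps + 2"
    let ?q = "if p then Crossing (?k + 1) ?k b d else Crossing d (?k + 1) ?k b"
    let ?q' = "crossing_piece (p \<noteq> (length ps \<in> S)) b d ?k (?k + 1)"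
    have "list_all2 turn_equal (switch S (ps @ [?q])) (ps' @ [?q'])"
      unfolding switch_append
      by (intro list_all2_appendI Cons.prems(1)) (auto simp: crossing_piece.simps)
    moreover have "\<forall>r\<in>set (ps @ [?q]). is_crossing r"
      using Cons.prems(2) by simp
    moreover have "fold step (x # w) (Four_Tangle ps a b c d) = fold step w (Four_Tangle (ps @ [?q]) a ?k c (?k + 1))"
      by (simp add: Some Let_def)
    moreover have "closure (switch_word S (length ps) (x # w)) ?k (mset ps') a b c d =
        closure (switch_word S (length (ps @ [?q])) w) (2 * length (ps @ [?q]) + 2) (mset (ps' @ [?q'])) a ?k c (?k + 1)"
      by (simp add: Some)
    moreover have "length ps + twists (x # w) = length (ps @ [?q]) + twists w"
      by (simp add: Some)
    ultimately show ?thesis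
      using Cons.IH[of "ps @ [?q]" "ps' @ [?q']" a ?k c "?k + 1"] by presburger
  qed
qed

lemma conway_diagram_switch:
  assumes "cs \<noteq> []" "hd cs \<noteq> 0"
  shows "crossings (conway_diagram cs) = {..<twists (conway_word cs)}"
    and "is_unknot (switch S (conway_diagram cs)) \<longleftrightarrow>
      isotopic (diagram_of_word (switch_word S 0 (conway_word cs))) {#Arc 0 0#}"
proof -
  let ?D = "diagram_of_word (switch_word S 0 (conway_word cs))"
  obtain qs qs' nw ne sw se where qs: "conway_tangle cs = Four_Tangle qs nw ne sw se"
    "list_all2 turn_equal (switch S qs) qs'" "\<forall>p\<in>set qs. is_crossing p"
    "length qs = twists (conway_word cs)" "?D = mset qs' + {#Arc nw ne, Arc sw se#}"
    using fold_step_switch[of S "[]" "[]" "conway_word cs" 0 1 0 1] assms(1)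
    by (auto simp: conway_tangle_step numeral_2_eq_2)
  have D: "conway_diagram cs = qs @ [Arc nw ne, Arc sw se]"
    by (simp add: conway_diagram_def qs(1))
  show "crossings (conway_diagram cs) = {..<twists (conway_word cs)}"
    using qs(3,4) by (auto simp: D crossings_def nth_append nth_Cons' split: if_splits)
  have eq: "mset (switch S (conway_diagram cs)) = mset (switch S qs) + {#Arc nw ne, Arc sw se#}"
    unfolding D using switch_append[of S "qs @ [Arc nw ne]"] switch_append[of S qs] by simp
  obtain c cs' where cs: "cs = c # cs'" "c \<noteq> 0"
    using assms by (cases cs) auto
  then obtain n where "nat \<bar>c\<bar> = Suc n"
    by (cases "nat \<bar>c\<bar>") auto
  \<comment> \<open>As the first entry is nonzero, the word starts with a reflection and a crossing,
    and this makes the closure planar.\<close>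
  with cs(1) have "\<exists>p w. switch_word S 0 (conway_word cs) = None # Some p # w"
    by simp
  then have "planar_diagram ?D"
    using planar_strands_closure by auto
  moreover have "list_all2 turn_equal qs' (switch S qs)"
    using qs(2) by (auto simp: list_all2_conv_all_nth)
  ultimately have "isotopic ?D (mset (switch S (conway_diagram cs)))"
    using planar_diagram_turns unfolding qs(5) eq by blast
  then show "is_unknot (switch S (conway_diagram cs)) \<longleftrightarrow> isotopic ?D {#Arc 0 0#}"
    unfolding is_unknot_def using isotopic_trans isotopic_sym by blast
qed


section \<open>Independence systems\<close>

text \<open>Elements of \<open>M\<close> outside \<open>N\<close> are exchanged one by one for
  elements of \<open>N\<close>; this preserves the size and shrinks \<open>M - N\<close> until the
  set lies inside \<open>N\<close>.\<close>

lemma card_maximal_members_le: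
  assumes "exchange_property I" "maximal_member I M" "maximal_member I N" "finite M" "finite N"
  shows "card M \<le> card N"
  using assms(2,4)
proof (induction "card (M - N)" arbitrary: M rule: less_induct)
  case less
  show ?case
  proof (cases "M \<subseteq> N")
    case True
    with assms(5) show ?thesis by (rule card_mono)
  next
    case False
    then obtain x where x: "x \<in> M" "x \<notin> N" by auto
    then obtain y where y: "y \<in> N" "maximal_member I ((M - {x}) \<union> {y})"
      using assms(1,3) less(2) unfolding exchange_property_def by blast
    let ?M = "(M - {x}) \<union> {y}"
    \<comment> \<open>Otherwise the exchanged set would lie inside \<open>M\<close> and by
      maximality equal it, although it lacks \<open>x\<close>.\<close>
    have "y \<notin> M"
    proof
      assume "y \<in> M"
      then have "?M \<subseteq> M" by auto
      with y(2) less(2) have "?M = M"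
        unfolding maximal_member_def by blast
      with x y show False by blast
    qed
    then have "card ?M = card M"
      using x less(3) by (simp add: card.insert_remove Suc_diff_Suc card_gt_0_iff)
        (metis card_Diff_singleton card_gt_0_iff empty_iff Suc_pred)
    moreover have "?M - N \<subset> M - N"
      using x y by auto
    then have "card (?M - N) < card (M - N)"
      using less(3) by (intro psubset_card_mono) auto
    ultimately show ?thesis
      using less(1)[of ?M] y(2) less(3) by simp
  qed
qed

lemma U_independent_finite: "U_independent D W \<Longrightarrow> finite W"
  unfolding U_independent_def crossings_def by (auto intro: finite_subset)

lemma U_independent_iff:
  "U_independent D W \<longleftrightarrow> W \<subseteq> crossings D \<and> (\<forall>S. S \<subset> W \<longrightarrow> \<not> unknotting_set D S)"
proof -
  have "(\<forall>S. S \<noteq> {} \<and> S \<subseteq> W \<longrightarrow> \<not> unknotting_set D (W - S)) \<longleftrightarrow> (\<forall>S. S \<subset> W \<longrightarrow> \<not> unknotting_set D S)"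
  proof (intro iffI allI impI)
    fix S assume *: "\<forall>S. S \<noteq> {} \<and> S \<subseteq> W \<longrightarrow> \<not> unknotting_set D (W - S)" and "S \<subset> W"
    then have "W - S \<noteq> {} \<and> W - S \<subseteq> W" "W - (W - S) = S" by auto
    with * show "\<not> unknotting_set D S" by metis
  next
    fix S assume *: "\<forall>S. S \<subset> W \<longrightarrow> \<not> unknotting_set D S" and "S \<noteq> {} \<and> S \<subseteq> W"
    then have "W - S \<subset> W" by auto
    with * show "\<not> unknotting_set D (W - S)" by blast
  qed
  then show ?thesis by (simp add: U_independent_def)
qed

text \<open>A minimal unknotting subset of \<open>B\<close> is a maximal U-independent set, and so is any maximal
  extension of \<open>A\<close>; their sizes differ.\<close>

lemma not_matroid_U:
  assumes B: "unknotting_set D B" and A: "U_independent D A" and card: "card B < card A"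
  shows "\<not> matroid (U_independence_system D)"
proof
  let ?I = "{W. U_independent D W}"
  assume "matroid (U_independence_system D)"
  then have exchange: "exchange_property ?I"
    by (simp add: matroid_def U_independence_system_def)
  have fin: "finite (crossings D)" by (simp add: crossings_def)
  have "finite B" using B fin by (auto simp: unknotting_set_def intro: finite_subset)
  then have "finite {S. S \<subseteq> B \<and> unknotting_set D S}" by simp
  then obtain M where "M \<in> {S. S \<subseteq> B \<and> unknotting_set D S}"
    "\<forall>S\<in>{S. S \<subseteq> B \<and> unknotting_set D S}. S \<subseteq> M \<longrightarrow> M = S"
    using finite_has_minimal[of "{S. S \<subseteq> B \<and> unknotting_set D S}"] B by blast
  then have M: "M \<subseteq> B" "unknotting_set D M" "\<And>S. S \<subset> M \<Longrightarrow> \<not> unknotting_set D S" by blast+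
  then have "U_independent D M"
    by (simp add: U_independent_iff unknotting_set_def)
  \<comment> \<open>A proper superset of \<open>M\<close> has the unknotting set \<open>M\<close> as
    a proper subset.\<close>
  moreover have "X = M" if "U_independent D X" "M \<subseteq> X" for X
    using that M(2) by (auto simp: U_independent_iff psubset_eq)
  ultimately have "maximal_member ?I M"
    unfolding maximal_member_def by blast
  have "finite {W. U_independent D W \<and> A \<subseteq> W}"
    using fin by (auto simp: U_independent_def intro: rev_finite_subset[of "Pow (crossings D)"])
  then obtain N where N: "N \<in> {W. U_independent D W \<and> A \<subseteq> W}"
    "\<forall>X\<in>{W. U_independent D W \<and> A \<subseteq> W}. N \<subseteq> X \<longrightarrow> N = X"
    using finite_has_maximal[of "{W. U_independent D W \<and> A \<subseteq> W}"] A by blast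
  then have "maximal_member ?I N"
    unfolding maximal_member_def by blast
  moreover have "finite N" "finite M"
    using N U_independent_finite finite_subset[OF M(1) \<open>finite B\<close>] by auto
  ultimately have "card N \<le> card M"
    using card_maximal_members_le[OF exchange _ \<open>maximal_member ?I M\<close>] by blast
  moreover have "card M \<le> card B" "card A \<le> card N"
    using M(1) N(1) \<open>finite B\<close> \<open>finite N\<close> by (auto intro: card_mono)
  ultimately show False using card by simp
qed

text \<open>The hypotheses make the U-independent sets exactly those of size at most
  \<open>n\<close>, so the system is the uniform matroid of rank \<open>n\<close>.\<close>

lemma matroid_uniform_U:
  assumes "\<And>S. S \<subseteq> crossings D \<Longrightarrow> card S = n \<Longrightarrow> unknotting_set D S"
    and "\<And>S. S \<subseteq> crossings D \<Longrightarrow> card S < n \<Longrightarrow> \<not> unknotting_set D S"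
    and "n \<le> card (crossings D)"
  shows "matroid (U_independence_system D)"
proof -
  have fin: "finite (crossings D)" by (simp add: crossings_def)
  have indep: "U_independent D W \<longleftrightarrow> W \<subseteq> crossings D \<and> card W \<le> n" for W
  proof (cases "W \<subseteq> crossings D")
    case True
    then have "finite W" using fin finite_subset by blast
    show ?thesis
    proof (cases "card W \<le> n")
      case True
      have "\<not> unknotting_set D S" if "S \<subset> W" for S
        using psubset_card_mono[OF \<open>finite W\<close> that] True assms(2)[of S] that \<open>W \<subseteq> crossings D\<close> by auto
      with True \<open>W \<subseteq> crossings D\<close> show ?thesis by (simp add: U_independent_iff)
    next
      case False
      then obtain S where "S \<subseteq> W" "card S = n"
        using obtain_subset_with_card_n[of n W] by auto
      then have "S \<subset> W" "unknotting_set D S"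
        using False assms(1)[of S] True by auto
      with False show ?thesis by (auto simp: U_independent_iff)
    qed
  qed (simp add: U_independent_iff)
  have maximal: "maximal_member {W. U_independent D W} M \<longleftrightarrow> M \<subseteq> crossings D \<and> card M = n" for M
  proof
    assume M: "maximal_member {W. U_independent D W} M"
    then have M': "M \<subseteq> crossings D" "card M \<le> n" "finite M"
      using fin finite_subset by (auto simp: maximal_member_def indep)
    have "card M = n"
    proof (rule ccontr)
      assume "card M \<noteq> n"
      then have "card M < card (crossings D)" using M' assms(3) by simp
      then obtain x where "x \<in> crossings D" "x \<notin> M"
        using M' by (metis fin card_mono leD subsetI)
      moreover from this have "U_independent D (insert x M)"
        using M' \<open>card M \<noteq> n\<close> by (simp add: indep)
      ultimately show False
        using M unfolding maximal_member_def by blast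
    qed
    with M' show "M \<subseteq> crossings D \<and> card M = n" by simp
  next
    assume M: "M \<subseteq> crossings D \<and> card M = n"
    have "X = M" if "X \<subseteq> crossings D" "card X \<le> n" "M \<subseteq> X" for X
      using that M card_seteq[of X M] fin finite_subset by metis
    with M show "maximal_member {W. U_independent D W} M"
      by (auto simp: maximal_member_def indep)
  qed
  have "exchange_property {W. U_independent D W}"
    unfolding exchange_property_def maximal
  proof (intro allI impI ballI)
    fix M N x
    assume MN: "(M \<subseteq> crossings D \<and> card M = n) \<and> (N \<subseteq> crossings D \<and> card N = n)" and x: "x \<in> M"
    then have fin': "finite M" "finite N" using fin finite_subset by blast+
    show "\<exists>y\<in>N. M - {x} \<union> {y} \<subseteq> crossings D \<and> card (M - {x} \<union> {y}) = n"
    proof (cases "x \<in> N")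
      case True
      moreover have "M - {x} \<union> {x} = M" using x by auto
      ultimately show ?thesis using MN by auto
    next
      case False
      then have "\<not> N \<subseteq> M" using MN x fin' card_seteq[of M N] by auto
      then obtain y where y: "y \<in> N" "y \<notin> M" by auto
      have "card M > 0" using x fin' by (auto simp: card_gt_0_iff)
      then have "card (M - {x} \<union> {y}) = n"
        using MN x y fin' by simp
      with MN y show ?thesis by blast
    qed
  qed
  then show ?thesis
    using independence_system_U[of D] by (simp add: matroid_def U_independence_system_def)
qed


section \<open>The three families of diagrams\<close>

text \<open>Each switch lowers the signed length of the row by 2. With \<open>n\<close> switches it
  becomes 1 and the row unwinds; with fewer it exceeds 1 and is itself the modulus of a nontrivial
  colouring.\<close>

lemma matroid_twist:
  assumes "n \<ge> 1"
  shows "matroid (U_independence_system (conway_diagram [2 * int n + 1]))"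
proof -
  let ?D = "conway_diagram [2 * int n + 1]"
  have word: "conway_word [2 * int n + 1] = None # replicate (2 * n + 1) (Some True)"
    by (simp add: nat_add_distrib nat_mult_distrib)
  have crossings: "crossings ?D = {..<2 * n + 1}"
    using conway_diagram_switch(1)[of "[2 * int n + 1]"] word by simp
  have unknot: "is_unknot (switch S ?D) \<longleftrightarrow>
      isotopic (diagram_of_word (None # map Some (map (\<lambda>j. j \<notin> S) [0..<2 * n + 1]))) {#Arc 0 0#}" for S
    using conway_diagram_switch(2)[of "[2 * int n + 1]" S] switch_word_replicate[of S 0 "2 * n + 1"]
    unfolding word by (simp del: replicate.simps upt_Suc)
  have signed_length: "signed_length (map (\<lambda>j. j \<notin> S) [0..<2 * n + 1]) = 2 * int n + 1 - 2 * int (card S)"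
    if "S \<subseteq> {..<2 * n + 1}" for S
  proof -
    have "S \<inter> {0..<2 * n + 1} = S" using that by auto
    then show ?thesis using signed_length_switched[of S 0 "2 * n + 1"] by (simp del: upt_Suc)
  qed
  show ?thesis
  proof (rule matroid_uniform_U[of _ n])
    fix S assume S: "S \<subseteq> crossings ?D" "card S = n"
    then have "signed_length (map (\<lambda>j. j \<notin> S) [0..<2 * n + 1]) = 1"
      using signed_length[of S] crossings by simp
    from isotopic_row[OF this] show "unknotting_set ?D S"
      unfolding unknotting_set_def unknot using S(1) by simp
  next
    fix S assume S: "S \<subseteq> crossings ?D" "card S < n"
    let ?w = "map (\<lambda>j. j \<notin> S) [0..<2 * n + 1]"
    have "signed_length ?w > 1"
      using S signed_length[of S] crossings by simp
    \<comment> \<open>After the reflection the ends carry 0, 0, 1, 1, and the row adds its signed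
      length to both right ends, so this length is what has to vanish modulo
      \<open>m\<close>.\<close>
    then have "\<not> isotopic (diagram_of_word (None # map Some ?w)) {#Arc 0 0#}"
      using end_colours_row[of ?w "[]" 0 0 1 1] by (intro not_unknot[of "signed_length ?w"]) (auto simp del: upt_Suc)
    then show "\<not> unknotting_set ?D S"
      unfolding unknotting_set_def unknot by simp
  qed (simp add: crossings)
qed

lemma not_matroid_two_rows:
  assumes "n \<ge> 2"
  shows "\<not> matroid (U_independence_system (conway_diagram [2 * int n, 2]))"
proof -
  let ?D = "conway_diagram [2 * int n, 2]"
  let ?w = "\<lambda>S. map (\<lambda>j. j \<notin> S) [0..<2 * n]"
  have word: "conway_word [2 * int n, 2] = None # replicate (2 * n) (Some True) @ [None, Some True, Some True]"
    using assms by (simp add: nat_mult_distrib numeral_eq_Suc)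
  have crossings: "crossings ?D = {..<2 * n + 2}"
    using conway_diagram_switch(1)[of "[2 * int n, 2]"] assms word by simp
  have unknot: "is_unknot (switch S ?D) \<longleftrightarrow> isotopic (diagram_of_word
      (None # map Some (?w S) @ [None, Some (2 * n \<notin> S), Some (2 * n + 1 \<notin> S)])) {#Arc 0 0#}" for S
    using conway_diagram_switch(2)[of "[2 * int n, 2]" S] switch_word_replicate[of S 0 "2 * n"] assms
    unfolding word by (simp add: switch_word_append)
  \<comment> \<open>Crossing \<open>2 * n\<close> is the first of the second row, so switching it
    leaves the first row unchanged.\<close>
  have row: "?w {2 * n} = replicate (2 * n) True"
    by (auto intro!: nth_equalityI)
  show ?thesis
  proof (rule not_matroid_U[of _ "{2 * n}" "{0, 1}"])
    obtain i where i: "2 * n = Suc i" using assms by (cases n) auto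
    \<comment> \<open>The second row now has opposite signs and cancels; what is left is the first
      row followed by a reflection.\<close>
    have "isotopic (strands_closure ((map Some (?w {2 * n}) @ [None]) @ [Some False, Some True]))
        (strands_closure (map Some (?w {2 * n}) @ [None]))"
      unfolding row using isotopic_cancel_strands[of "map Some (replicate (2 * n) True) @ [None]" "[]" False] i
      by (simp add: ex_bool_eq)
    also have "isotopic \<dots> {#Arc 0 0#}"
      by (rule isotopic_vertical_row)
    finally show "unknotting_set ?D {2 * n}"
      unfolding unknotting_set_def unknot crossings by simp
  next
    have "\<not> is_unknot (switch S ?D)" if S: "S \<subset> {0, 1}" for S
    proof -
      \<comment> \<open>At most one crossing of the first row is switched, so its signed length is
        at least \<open>2 * n - 2\<close>.\<close>
      have "card S < card {0, 1 :: nat}" using S by (intro psubset_card_mono) auto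
      moreover have "S \<inter> {0..<2 * n} = S" using S assms by auto
      ultimately have s: "signed_length (?w S) \<ge> 2"
        using signed_length_switched[of S 0 "2 * n"] assms by simp
      let ?v = "None # map Some (?w S) @ [None, Some True, Some True]"
      \<comment> \<open>Both pairs of ends to be joined differ by
        \<open>1 + 2 * signed_length (?w S)\<close>, which therefore serves as the modulus.\<close>
      have E: "end_colours ?v (0, 1, 0, 1) =
          (0, 1 + 2 * signed_length (?w S), signed_length (?w S), 1 + 3 * signed_length (?w S))"
        by (simp add: end_colours_row Let_def del: map_map)
      have "\<not> isotopic (diagram_of_word ?v) {#Arc 0 0#}"
        by (rule not_unknot[OF _ E, of "1 + 2 * signed_length (?w S)"]) (use s in \<open>simp_all add: add.commute\<close>)
      moreover have "2 * n \<notin> S" "2 * n + 1 \<notin> S" using S assms by auto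
      ultimately show ?thesis
        unfolding unknot by (simp only: not_False_eq_True)
    qed
    then show "U_independent ?D {0, 1}"
      using assms by (auto simp: U_independent_iff crossings unknotting_set_def)
  qed simp
qed

text \<open>Blocks are removed from the right: the switched row \<open>2\<close> of the last block
  cancels, the two reflections around it meet and cancel, and its row \<open>-2\<close> merges into
  the final row. That lowers the signed length by 2 per block, down to 1.\<close>

lemma isotopic_D_unknot:
  assumes "signed_length w = 2 * int n + 1"
  shows "isotopic (diagram_of_word (concat (replicate n [None, Some False, Some False, None, Some True, Some False])
    @ None # map Some w)) {#Arc 0 0#}"
  using assms
proof (induction n arbitrary: w)
  case 0
  then show ?case using isotopic_row by simp
next
  case (Suc n)
  let ?block = "[None, Some False, Some False, None, Some True, Some False]"
  let ?u = "concat (replicate n ?block) @ [None, Some False, Some False, None]"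
  obtain u where u: "?u = None # Some False # u"
    by (cases n) auto
  have "replicate (Suc n) ?block = replicate n ?block @ [?block]"
    by (simp add: replicate_append_same)
  then have "concat (replicate (Suc n) ?block) @ None # map Some w =
      ?u @ Some True # Some (\<not> True) # None # map Some w"
    by (simp del: replicate.simps)
  then have "isotopic (diagram_of_word (concat (replicate (Suc n) ?block) @ None # map Some w))
      (diagram_of_word (?u @ None # map Some w))"
    unfolding u using isotopic_cancel_strands[of "Some False # u" "None # map Some w" True]
    by (simp add: ex_bool_eq del: replicate.simps)
  also have "diagram_of_word (?u @ None # map Some w) =
      diagram_of_word (concat (replicate n ?block) @ None # map Some (False # False # w))"
    using closure_None_None[of "concat (replicate n ?block) @ [None, Some False, Some False]" "map Some w"]
    by simp
  also have "isotopic \<dots> {#Arc 0 0#}"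
    using Suc by (intro Suc.IH) simp
  finally show ?case .
qed

text \<open>Each block raises \<open>k\<close> by 1 and reverses the common sign \<open>e\<close>.
  The start colours 0, 1, 0, 1 are the case \<open>k = 0\<close>, \<open>e = 1\<close>.\<close>

lemma end_colours_D:
  "end_colours (concat (replicate r [None, Some False, Some False, None, Some True, Some True]) @ v)
    (0, e * (2 * k + 1), e * (2 * k), e * (4 * k + 1)) =
   end_colours v (0, (- 1) ^ r * e * (2 * (k + int r) + 1), (- 1) ^ r * e * (2 * (k + int r)),
     (- 1) ^ r * e * (4 * (k + int r) + 1))"
proof (induction r arbitrary: e k)
  case (Suc r)
  have "end_colours (concat (replicate (Suc r) [None, Some False, Some False, None, Some True, Some True]) @ v)
      (0, e * (2 * k + 1), e * (2 * k), e * (4 * k + 1)) =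
    end_colours (concat (replicate r [None, Some False, Some False, None, Some True, Some True]) @ v)
      (0, (- e) * (2 * (k + 1) + 1), (- e) * (2 * (k + 1)), (- e) * (4 * (k + 1) + 1))"
    by (simp add: Let_def algebra_simps)
  also note Suc.IH
  finally show ?case by (simp add: algebra_simps)
qed simp

lemma twists_concat_replicate: "twists (concat (replicate n w)) = n * twists w"
  by (induction n) auto

lemma not_matroid_D:
  assumes "n \<ge> 2"
  shows "\<not> matroid (U_independence_system (D_diagram n))"
proof -
  let ?cs = "concat (replicate n [- 2, 2]) @ [2 * int n + 1]"
  let ?b = "[None, Some False, Some False, None, Some True, Some True]"
  let ?b' = "[None, Some False, Some False, None, Some True, Some False]"
  let ?w = "\<lambda>S. map (\<lambda>j. j \<notin> S) [4 * n..<4 * n + (2 * n + 1)]"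
  have "conway_word (concat (replicate r [- 2, 2])) = concat (replicate r ?b)" for r
    by (induction r) (simp_all add: numeral_eq_Suc)
  then have word: "conway_word ?cs = concat (replicate n ?b) @ None # replicate (2 * n + 1) (Some True)"
    by (simp add: nat_add_distrib nat_mult_distrib)
  have cs: "?cs \<noteq> []" "hd ?cs \<noteq> 0"
    using assms by (cases n; simp)+
  have crossings: "crossings (D_diagram n) = {..<6 * n + 1}"
    unfolding D_diagram_def conway_diagram_switch(1)[OF cs] word
    by (simp add: twists_concat_replicate)
  have twists: "twists (concat (replicate n ?b)) = 4 * n"
    by (simp add: twists_concat_replicate)
  have unknot: "is_unknot (switch S (D_diagram n)) \<longleftrightarrow> isotopic (diagram_of_word
      (switch_word S 0 (concat (replicate n ?b)) @ None # map Some (?w S))) {#Arc 0 0#}" for S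
    unfolding D_diagram_def conway_diagram_switch(2)[OF cs] word switch_word_append twists
    by (simp only: add_0 switch_word.simps switch_word_replicate)
  show ?thesis
  \<comment> \<open>A block has four crossings, so \<open>4 * i + 3\<close> is the last crossing of
    the \<open>i\<close>-th row \<open>2\<close>, counting from 0, and the final row starts at
    \<open>4 * n\<close>. Its first \<open>n + 1\<close> crossings form the larger set.\<close>
  proof (rule not_matroid_U[of _ "(\<lambda>i. 4 * i + 3) ` {..<n}" "{4 * n..<4 * n + (n + 1)}"])
    let ?B = "(\<lambda>i. 4 * i + 3) ` {..<n}"
    have mem: "4 * i \<notin> ?B" "4 * i + 1 \<notin> ?B" "4 * i + 2 \<notin> ?B" "i < n \<Longrightarrow> 4 * i + 3 \<in> ?B" for i
      by (auto simp: image_iff) presburger+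
    have "switch_word ?B (4 * i) (concat (replicate r ?b)) = concat (replicate r ?b')" if "i + r \<le> n" for i r
      using that
    proof (induction r arbitrary: i)
      case (Suc r)
      then have "switch_word ?B (4 * (i + 1)) (concat (replicate r ?b)) = concat (replicate r ?b')"
        by (intro Suc.IH) simp
      moreover have "i < n" using Suc.prems by simp
      ultimately show ?case
        using mem[of i] by (simp add: numeral_eq_Suc)
    qed simp
    from this[of 0 n] have blocks: "switch_word ?B 0 (concat (replicate n ?b)) = concat (replicate n ?b')"
      by simp
    have "?B \<inter> {4 * n..<4 * n + (2 * n + 1)} = {}" by auto
    then have "signed_length (?w ?B) = 2 * int n + 1"
      using signed_length_switched[of ?B "4 * n" "2 * n + 1"] by simp
    from isotopic_D_unknot[OF this] show "unknotting_set (D_diagram n) ?B"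
      unfolding unknotting_set_def unknot blocks crossings by auto
  next
    let ?A = "{4 * n..<4 * n + (n + 1)}"
    have "\<not> is_unknot (switch S (D_diagram n))" if S: "S \<subset> ?A" for S
    proof -
      \<comment> \<open>At most \<open>n\<close> of the \<open>2 * n + 1\<close> final crossings are
        switched, so the signed length stays at least 1.\<close>
      have "card S < card ?A" using S by (intro psubset_card_mono) auto
      moreover have "S \<inter> {4 * n..<4 * n + (2 * n + 1)} = S" using S by auto
      ultimately have s: "signed_length (?w S) \<ge> 1"
        using signed_length_switched[of S "4 * n" "2 * n + 1"] by simp
      have "switch_word S 0 (concat (replicate n ?b)) = concat (replicate n ?b)"
        using S by (intro switch_word_ident) (auto simp: twists_concat_replicate)
      \<comment> \<open>The determinant: up to the sign \<open>(- 1) ^ n\<close>, both closing arcs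
        join colours that differ by \<open>m\<close>.\<close>
      moreover define m where "m = 2 * int n + signed_length (?w S) * (2 * int n + 1)"
      have "2 * int n + 1 \<le> signed_length (?w S) * (2 * int n + 1)"
        using mult_right_mono[OF s, of "2 * int n + 1"] by simp
      then have "m > 1" using assms unfolding m_def by linarith
      moreover have "end_colours (concat (replicate n ?b) @ None # map Some (?w S)) (0, 1, 0, 1) =
          (0, (- 1) ^ n * m, (- 1) ^ n * (2 * int n + 1), (- 1) ^ n * m + (- 1) ^ n * (2 * int n + 1))"
        using end_colours_D[of n "None # map Some (?w S)" 1 0] end_colours_row[of "?w S" "[]"]
        by (simp add: m_def algebra_simps del: upt_Suc)
      ultimately show ?thesis
        unfolding unknot using not_unknot[of m] by simp
    qed
    then show "U_independent (D_diagram n) ?A"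
      by (auto simp: U_independent_iff crossings unknotting_set_def)
  next
    have "inj_on (\<lambda>i. 4 * i + 3 :: nat) {..<n}" by (auto simp: inj_on_def)
    then show "card ((\<lambda>i. 4 * i + 3) ` {..<n}) < card {4 * n..<4 * n + (n + 1)}"
      by (simp add: card_image)
  qed
qed

theorem proposition2p6:
  shows "(\<forall>n\<ge>(2::nat). \<not> matroid (U_independence_system (D_diagram n))) \<and>
         (\<forall>n\<ge>(1::nat). matroid (U_independence_system (conway_diagram [2 * int n + 1]))) \<and>
         (\<forall>n\<ge>(2::nat). \<not> matroid (U_independence_system (conway_diagram [2 * int n, 2])))"
  using not_matroid_D matroid_twist not_matroid_two_rows by blast

end
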